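(* Let $N\ge 1$, let $s^{\{1\}},\dots,s^{\{N\}}\ge 1$, and consider the GARK method with real coefficients $a_{i,j}^{\{q,m\}}$, $b_i^{\{q\}}$ ($q,m=1,\dots,N$; $i=1,\dots,s^{\{q\}}$; $j=1,\dots,s^{\{m\}}$). The order conditions of the GARK method are obtained from the order conditions of ordinary Runge-Kutta methods by accompanying each coefficient subscript (stage index) with a matching superscript (color), the colors being arbitrary. That is, the GARK method has order $p$ if and only if, for every N-tree $u$ with $1\le \rho(u)\le p$, $$\sum_{(i_v)_{v\in V(u)}} b^{\{\kappa(r)\}}_{i_r}\ \prod_{(v,w)\in E(u)} a^{\{\kappa(v),\kappa(w)\}}_{i_v,i_w}\;=\;\frac{1}{\gamma(u)},$$ where $V(u)$ is the set of vertices of $u$, $r$ is its root, $E(u)$ is the set of edges $(v,w)$ with $v$ the parent of $w$, $\kappa(v)\in\{1,\dots,N\}$ is the color of the vertex $v$, and the sum is over all assignments of an index $i_v\in\{1,\dots,s^{\{\kappa(v)\}}\}$ to each vertex $v\in V(u)$.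
   Context: Additively partitioned system: $y'=f(y)=\sum_{m=1}^N f^{\{m\}}(y)$, $y(t_0)=y_0$, with $f^{\{m\}}:\mathbb{R}^d\to\mathbb{R}^d$. GARK method: one step of size $h$ from $y_n$ is $$Y_i^{\{q\}} = y_n + h\sum_{m=1}^N\sum_{j=1}^{s^{\{m\}}} a_{i,j}^{\{q,m\}} f^{\{m\}}\big(Y_j^{\{m\}}\big),\quad i=1,\dots,s^{\{q\}},\ q=1,\dots,N,$$ $$y_{n+1}=y_n+h\sum_{q=1}^N\sum_{i=1}^{s^{\{q\}}} b_i^{\{q\}} f^{\{q\}}\big(Y_i^{\{q\}}\big).$$ Order: the method has order $p$ if for all $d$ and all smooth $f^{\{1\}},\dots,f^{\{N\}}$ the Taylor expansions in $h$ of $y_{n+1}$ and of the exact solution at $t_n+h$ started from $y_n$ at $t_n$ agree through the terms of order $h^p$. N-trees: an N-tree is a rooted (Butcher) tree each of whose vertices is assigned one of $N$ colors $1,\dots,N$. $\rho(u)$ is the number of vertices of $u$. The one-vertex tree with color $\nu$ is $\tau^{[\nu]}$, and $[u_1,\dots,u_m]^{[\nu]}$ is the tree with root of color $\nu$ whose removal leaves the nonempty subtrees $u_1,\dots,u_m$. The density $\gamma$ is defined by $\gamma(\tau^{[\nu]})=1$ and $\gamma(u)=\rho(u)\gamma(u_1)\cdots\gamma(u_m)$ for $u=[u_1,\dots,u_m]^{[\nu]}$. For $N=1$ the displayed conditions are the classical Runge-Kutta order conditions. *)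

theory Defs
  imports "HOL-Analysis.Analysis" "HOL-Library.Multiset"
begin

text \<open>
  The definition of order quantifies over the dimension \<open>d\<close>, so \<open>\<real>\<^sup>d\<close> is the carrier of the
  library's \<^const>\<open>Euclidean_space\<close>, i.e. the functions \<open>nat \<Rightarrow> real\<close> vanishing at all
  indices \<open>\<ge> d\<close>. Colours and stage indices are natural numbers starting at 1.
\<close>

section \<open>Smooth vector fields and Taylor coefficients\<close>

abbreviation Rn :: "nat \<Rightarrow> (nat \<Rightarrow> real) set" where
  "Rn d \<equiv> topspace (Euclidean_space d)"

definition partial_deriv :: "nat \<Rightarrow> ((nat \<Rightarrow> real) \<Rightarrow> real) \<Rightarrow> (nat \<Rightarrow> real) \<Rightarrow> real" where
  "partial_deriv j F x = deriv (\<lambda>t. F (x(j := t))) (x j)"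

text \<open>\<open>C_class d k F\<close>: all partial derivatives of \<open>F\<close> on \<open>\<real>\<^sup>d\<close> up to order \<open>k\<close> exist and are
  continuous.\<close>

primrec C_class :: "nat \<Rightarrow> nat \<Rightarrow> ((nat \<Rightarrow> real) \<Rightarrow> real) \<Rightarrow> bool" where
  "C_class d 0 F \<longleftrightarrow> continuous_map (Euclidean_space d) euclideanreal F"
| "C_class d (Suc k) F \<longleftrightarrow>
     continuous_map (Euclidean_space d) euclideanreal F \<and>
     (\<forall>j<d. (\<forall>x\<in>Rn d. (\<lambda>t. F (x(j := t))) differentiable (at (x j))) \<and>
            C_class d k (partial_deriv j F))"

definition smooth_field :: "nat \<Rightarrow> ((nat \<Rightarrow> real) \<Rightarrow> (nat \<Rightarrow> real)) \<Rightarrow> bool" where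
  "smooth_field d g \<longleftrightarrow> g \<in> Rn d \<rightarrow> Rn d \<and> (\<forall>i<d. \<forall>k. C_class d k (\<lambda>x. g x i))"

definition smooth_real_on :: "real set \<Rightarrow> (real \<Rightarrow> real) \<Rightarrow> bool" where
  "smooth_real_on S g \<longleftrightarrow> (\<forall>n. \<forall>x\<in>S. (deriv ^^ n) g differentiable (at x))"

definition taylor_coeff :: "(real \<Rightarrow> real) \<Rightarrow> nat \<Rightarrow> real" where
  "taylor_coeff g n = (deriv ^^ n) g 0 / fact n"

section \<open>GARK methods and their order\<close>

text \<open>\<open>s q\<close> is the number of stages of colour \<open>q\<close>; \<open>a q m i j\<close> and \<open>b q i\<close> are
  \<open>a\<^sub>i\<^sub>,\<^sub>j\<close> with superscript \<open>{q,m}\<close> and \<open>b\<^sub>i\<close> with superscript \<open>{q}\<close>; \<open>Y q i\<close> is the stage vector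
  \<open>Y\<^sub>i\<close> with superscript \<open>{q}\<close>.\<close>

definition gark_stages ::
  "nat \<Rightarrow> (nat \<Rightarrow> nat) \<Rightarrow> (nat \<Rightarrow> nat \<Rightarrow> nat \<Rightarrow> nat \<Rightarrow> real) \<Rightarrow>
   (nat \<Rightarrow> (nat \<Rightarrow> real) \<Rightarrow> (nat \<Rightarrow> real)) \<Rightarrow> (nat \<Rightarrow> real) \<Rightarrow> real \<Rightarrow>
   (nat \<Rightarrow> nat \<Rightarrow> nat \<Rightarrow> real) \<Rightarrow> bool" where
  "gark_stages N s a f yn h Y \<longleftrightarrow>
     (\<forall>q\<in>{1..N}. \<forall>i\<in>{1..s q}.
        Y q i = (\<lambda>k. yn k + h * (\<Sum>m=1..N. \<Sum>j=1..s m. a q m i j * f m (Y m j) k)))"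

definition gark_update ::
  "nat \<Rightarrow> (nat \<Rightarrow> nat) \<Rightarrow> (nat \<Rightarrow> nat \<Rightarrow> real) \<Rightarrow>
   (nat \<Rightarrow> (nat \<Rightarrow> real) \<Rightarrow> (nat \<Rightarrow> real)) \<Rightarrow> (nat \<Rightarrow> real) \<Rightarrow> real \<Rightarrow>
   (nat \<Rightarrow> nat \<Rightarrow> nat \<Rightarrow> real) \<Rightarrow> (nat \<Rightarrow> real)" where
  "gark_update N s b f yn h Y =
     (\<lambda>k. yn k + h * (\<Sum>q=1..N. \<Sum>i=1..s q. b q i * f q (Y q i) k))"

text \<open>
  \<open>z h\<close> is the result of one step of size \<open>h\<close> from \<open>yn\<close>. The stage equations are implicit in
  general; near \<open>h = 0\<close> they are to be solved by stages depending smoothly on \<open>h\<close>. Since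
  \<open>h = 0\<close> forces every stage to be \<open>yn\<close>, for smooth \<open>f\<close> the implicit function theorem gives
  exactly one such family up to the choice of \<open>\<epsilon>\<close>.
\<close>

definition gark_solution ::
  "nat \<Rightarrow> nat \<Rightarrow> (nat \<Rightarrow> nat) \<Rightarrow> (nat \<Rightarrow> nat \<Rightarrow> nat \<Rightarrow> nat \<Rightarrow> real) \<Rightarrow> (nat \<Rightarrow> nat \<Rightarrow> real) \<Rightarrow>
   (nat \<Rightarrow> (nat \<Rightarrow> real) \<Rightarrow> (nat \<Rightarrow> real)) \<Rightarrow> (nat \<Rightarrow> real) \<Rightarrow> (real \<Rightarrow> nat \<Rightarrow> real) \<Rightarrow> bool" where
  "gark_solution d N s a b f yn z \<longleftrightarrow>
     (\<exists>\<epsilon>>0. \<exists>Y :: real \<Rightarrow> nat \<Rightarrow> nat \<Rightarrow> nat \<Rightarrow> real.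
        (\<forall>q\<in>{1..N}. \<forall>i\<in>{1..s q}.
           (\<forall>h\<in>{-\<epsilon><..<\<epsilon>}. Y h q i \<in> Rn d) \<and>
           (\<forall>k<d. smooth_real_on {-\<epsilon><..<\<epsilon>} (\<lambda>h. Y h q i k))) \<and>
        (\<forall>h\<in>{-\<epsilon><..<\<epsilon>}. gark_stages N s a f yn h (Y h) \<and>
                        z h = gark_update N s b f yn h (Y h)))"

definition exact_solution ::
  "nat \<Rightarrow> nat \<Rightarrow> (nat \<Rightarrow> (nat \<Rightarrow> real) \<Rightarrow> (nat \<Rightarrow> real)) \<Rightarrow> real \<Rightarrow> (nat \<Rightarrow> real) \<Rightarrow>
   (real \<Rightarrow> nat \<Rightarrow> real) \<Rightarrow> bool" where
  "exact_solution d N f tn yn y \<longleftrightarrow>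
     y tn = yn \<and>
     (\<exists>\<epsilon>>0. \<forall>t\<in>{tn - \<epsilon><..<tn + \<epsilon>}. y t \<in> Rn d \<and>
        (\<forall>k<d. ((\<lambda>t. y t k) has_real_derivative (\<Sum>m=1..N. f m (y t) k)) (at t)))"

definition gark_has_order ::
  "nat \<Rightarrow> (nat \<Rightarrow> nat) \<Rightarrow> (nat \<Rightarrow> nat \<Rightarrow> nat \<Rightarrow> nat \<Rightarrow> real) \<Rightarrow> (nat \<Rightarrow> nat \<Rightarrow> real) \<Rightarrow> nat \<Rightarrow> bool"
  where
  "gark_has_order N s a b p \<longleftrightarrow>
     (\<forall>d f tn yn y z.
        (\<forall>m\<in>{1..N}. smooth_field d (f m)) \<longrightarrow> yn \<in> Rn d \<longrightarrow>
        exact_solution d N f tn yn y \<longrightarrow> gark_solution d N s a b f yn z \<longrightarrow>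
        (\<forall>n\<le>p. \<forall>k<d. taylor_coeff (\<lambda>h. z h k) n = taylor_coeff (\<lambda>h. y (tn + h) k) n))"

section \<open>N-trees\<close>

text \<open>\<open>Node \<nu> {#u\<^sub>1, \<dots>, u\<^sub>m#}\<close> is the tree with root of colour \<open>\<nu>\<close> whose removal leaves
  \<open>u\<^sub>1, \<dots>, u\<^sub>m\<close>; siblings are unordered.\<close>

datatype ntree = Node (root_colour: nat) (subtrees: "ntree multiset")

text \<open>
  A vertex is addressed by the path leading to it from the root. As equal subtrees may occur
  repeatedly below a vertex, a step of a path is a pair \<open>(w, k)\<close>: descend to the \<open>k\<close>-th copy of the
  subtree \<open>w\<close>. The root is \<open>[]\<close>.
\<close>

type_synonym vertex = "(ntree \<times> nat) list"

fun is_vertex :: "ntree \<Rightarrow> vertex \<Rightarrow> bool" where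
  "is_vertex u [] \<longleftrightarrow> True"
| "is_vertex u ((w, k) # v) \<longleftrightarrow> k < count (subtrees u) w \<and> is_vertex w v"

definition verts :: "ntree \<Rightarrow> vertex set" where
  "verts u = {v. is_vertex u v}"

definition edges :: "ntree \<Rightarrow> (vertex \<times> vertex) set" where
  "edges u = {(v, v @ [x]) | v x. v \<in> verts u \<and> v @ [x] \<in> verts u}"

definition colour :: "ntree \<Rightarrow> vertex \<Rightarrow> nat" where
  "colour u v = root_colour (if v = [] then u else fst (last v))"

definition is_Ntree :: "nat \<Rightarrow> ntree \<Rightarrow> bool" where
  "is_Ntree N u \<longleftrightarrow> (\<forall>v\<in>verts u. colour u v \<in> {1..N})"

definition num_verts :: "ntree \<Rightarrow> nat" where
  "num_verts u = card (verts u)"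

primrec tree_density :: "ntree \<Rightarrow> nat" where
  "tree_density (Node \<nu> us) = num_verts (Node \<nu> us) * \<Prod>\<^sub># (image_mset tree_density us)"

lemma verts_Node:
  "verts (Node \<nu> us) =
     insert [] (\<Union>w\<in>set_mset us. \<Union>k<count us w. (\<lambda>v. (w, k) # v) ` verts w)"
proof (intro set_eqI iffI)
  fix v assume *: "v \<in> verts (Node \<nu> us)"
  show "v \<in> insert [] (\<Union>w\<in>set_mset us. \<Union>k<count us w. (\<lambda>v. (w, k) # v) ` verts w)"
  proof (cases v)
    case (Cons x v')
    obtain w k where x: "x = (w, k)" by fastforce
    from * have k: "k < count us w" and "v' \<in> verts w"
      by (auto simp: Cons x verts_def)
    moreover from k have "w \<in># us"
      by (metis gr_implies_not0 not_in_iff)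
    ultimately show ?thesis
      by (auto simp: Cons x)
  qed simp
qed (auto simp: verts_def)

lemma finite_verts: "finite (verts u)"
  by (induction u) (auto simp: verts_Node)

lemma tree_density_single: "tree_density (Node \<nu> {#}) = 1"
  by (simp add: num_verts_def verts_Node)

end

theory Submission
  imports Defs "HOL-Computational_Algebra.Formal_Power_Series"
begin

text \<open>
  The exact solution and the numerical solution are both governed by the same smooth fields
  \<open>f\<^sup>{m}\<close>, and their Taylor coefficients can be computed recursively, order by order: the coefficient of order
  \<open>n + 1\<close> of a solution is a linear combination of coefficients of order \<open>n\<close> of \<open>f\<^sup>{m} \<circ> x\<close> for curves \<open>x\<close> already
  known to order \<open>n\<close>, and those follow from the chain rule. Unfolding this recursion produces, in
  both cases, one and the same expression: a sum over \<open>N\<close>-trees of an elementary differential of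
  \<open>f\<close>, which is the same for both, times a weight of the tree, which is not. For the exact solution each step
  integrates a power of the time and the weight is \<open>1 / \<gamma>(u)\<close>; for the method each step multiplies by
  a row of the tableau and sums over stages, and the weight is the left-hand side of the order
  condition. So the conditions are sufficient.

  Comparing the two solutions only requires that the elementary differentials and their
  multiplicities are the same in both, not what they are. The common expression is therefore kept as
  an operator \<open>tree_expansion\<close>, defined by recursion along the chain rule and linear in an
  indeterminate weight function; \<open>exact_solution_coeff\<close> and \<open>gark_solution_coeff\<close> say that
  both solutions are given by this operator at the two weights, and both rest on
  \<open>taylor_coeff_compose_tree_expansion\<close>, the multiplicativity of the expansion.

  For necessity, a single tree \<open>u\<close> has to be isolated (\<open>tree_condition_if_order\<close>). There is a
  polynomial system, with coordinates indexed by a finite set of trees that contains \<open>u\<close> and all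
  its subtrees, whose exact and numerical solutions, started at the origin, are monomials in \<open>h\<close>, with the two weights as coefficients: each coordinate is driven by
  smaller subtrees only, so that even the equations of an implicit method are solved one after the other.

  The order condition itself, a sum over all assignments of indices to vertices, is first brought into
  recursive form (\<open>sum_over_index_assignments\<close>).
\<close>

section \<open>Real functions that can be differentiated repeatedly\<close>

text \<open>
  \<^const>\<open>smooth_real_on\<close> speaks of iterated derivatives of one function, which is awkward for products
  and compositions, since \<^const>\<open>deriv\<close> obeys the rules of calculus only where the factors are known to be
  differentiable. The recursion below names a derivative at each step, so that each closure property
  is a short induction. It also counts the derivatives, as needed to bootstrap the smoothness of
  solutions of an ODE.
\<close>

primrec diff_times :: "nat \<Rightarrow> real set \<Rightarrow> (real \<Rightarrow> real) \<Rightarrow> bool" where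
  "diff_times 0 S g \<longleftrightarrow> True"
| "diff_times (Suc n) S g \<longleftrightarrow>
     (\<exists>g'. (\<forall>t\<in>S. (g has_real_derivative g' t) (at t)) \<and> diff_times n S g')"

lemma has_real_derivative_cong_open:
  assumes "open S" "t \<in> S" "\<And>t. t \<in> S \<Longrightarrow> g t = h t"
  shows "(g has_real_derivative D) (at t) \<longleftrightarrow> (h has_real_derivative D) (at t)"
proof -
  have "eventually (\<lambda>t. g t = h t) (nhds t)"
    using assms eventually_nhds by blast
  then show ?thesis
    by (rule DERIV_cong_ev[OF refl _ refl])
qed

lemma diff_times_cong:
  assumes "open S" "\<And>t. t \<in> S \<Longrightarrow> g t = h t" "diff_times n S g"
  shows "diff_times n S h"
  using assms has_real_derivative_cong_open[OF assms(1) _ assms(2)] by (cases n) auto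

lemma diff_times_pred: "diff_times (Suc n) S g \<Longrightarrow> diff_times n S g"
  by (induction n arbitrary: g) (simp, metis diff_times.simps(2))

lemma diff_times_const: "diff_times n S (\<lambda>t. c)"
  by (induction n arbitrary: c) (auto intro!: exI[of _ "\<lambda>t. 0"])

lemma diff_times_id: "diff_times n S (\<lambda>t. t)"
  by (cases n) (auto intro!: exI[of _ "\<lambda>t. 1"] diff_times_const)

lemma diff_times_add:
  "diff_times n S g \<Longrightarrow> diff_times n S h \<Longrightarrow> diff_times n S (\<lambda>t. g t + h t)"
proof (induction n arbitrary: g h)
  case (Suc n)
  then obtain g' h' where
    "\<forall>t\<in>S. (g has_real_derivative g' t) (at t)" "diff_times n S g'"
    "\<forall>t\<in>S. (h has_real_derivative h' t) (at t)" "diff_times n S h'"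
    by auto
  then show ?case
    using Suc.IH by (auto intro!: exI[of _ "\<lambda>t. g' t + h' t"] derivative_eq_intros)
qed simp

lemma diff_times_mult:
  "diff_times n S g \<Longrightarrow> diff_times n S h \<Longrightarrow> diff_times n S (\<lambda>t. g t * h t)"
proof (induction n arbitrary: g h)
  case (Suc n)
  then obtain g' h' where *:
    "\<forall>t\<in>S. (g has_real_derivative g' t) (at t)" "diff_times n S g'"
    "\<forall>t\<in>S. (h has_real_derivative h' t) (at t)" "diff_times n S h'"
    by auto
  have "diff_times n S g" "diff_times n S h"
    by (rule diff_times_pred, rule Suc.prems)+
  then have "diff_times n S (\<lambda>t. g' t * h t + h' t * g t)"
    using * by (intro diff_times_add Suc.IH)
  moreover have "\<forall>t\<in>S. ((\<lambda>t. g t * h t) has_real_derivative g' t * h t + h' t * g t) (at t)"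
    using * by (auto intro!: DERIV_mult)
  ultimately show ?case by auto
qed simp

lemma diff_times_sum:
  assumes "\<And>i. i \<in> I \<Longrightarrow> diff_times n S (g i)"
  shows "diff_times n S (\<lambda>t. \<Sum>i\<in>I. g i t)"
  using assms
  by (induction I rule: infinite_finite_induct) (auto intro: diff_times_const diff_times_add)

lemma diff_times_Suc_iff_deriv:
  assumes "open S"
  shows "diff_times (Suc n) S g \<longleftrightarrow> (\<forall>t\<in>S. g differentiable (at t)) \<and> diff_times n S (deriv g)"
proof
  assume "diff_times (Suc n) S g"
  then obtain g' where *: "\<forall>t\<in>S. (g has_real_derivative g' t) (at t)" "diff_times n S g'"
    by auto
  then have "\<And>t. t \<in> S \<Longrightarrow> g' t = deriv g t"
    by (metis DERIV_imp_deriv)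
  then show "(\<forall>t\<in>S. g differentiable (at t)) \<and> diff_times n S (deriv g)"
    using * assms diff_times_cong real_differentiable_def by blast
next
  assume "(\<forall>t\<in>S. g differentiable (at t)) \<and> diff_times n S (deriv g)"
  then show "diff_times (Suc n) S g"
    by (auto simp: DERIV_deriv_iff_real_differentiable intro!: exI[of _ "deriv g"])
qed

lemma smooth_real_on_iff_diff_times:
  assumes "open S"
  shows "smooth_real_on S g \<longleftrightarrow> (\<forall>n. diff_times n S g)"
proof -
  have *: "diff_times n S g \<longleftrightarrow> (\<forall>k<n. \<forall>t\<in>S. (deriv ^^ k) g differentiable (at t))" for n
  proof (induction n arbitrary: g)
    case (Suc n)
    show ?case
      unfolding diff_times_Suc_iff_deriv[OF assms] Suc.IH
      by (simp add: All_less_Suc2 funpow_Suc_right del: funpow.simps)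
  qed simp
  show ?thesis
    unfolding smooth_real_on_def * by blast
qed

lemma smooth_real_on_has_deriv:
  "smooth_real_on S g \<Longrightarrow> t \<in> S \<Longrightarrow> (g has_real_derivative deriv g t) (at t)"
  unfolding smooth_real_on_def DERIV_deriv_iff_real_differentiable
  by (drule spec[of _ 0]) simp

lemma smooth_real_on_deriv: "smooth_real_on S g \<Longrightarrow> smooth_real_on S (deriv g)"
proof -
  have "(deriv ^^ n) (deriv g) = (deriv ^^ Suc n) g" for n
    by (simp add: funpow_Suc_right del: funpow.simps)
  then show "smooth_real_on S g \<Longrightarrow> smooth_real_on S (deriv g)"
    unfolding smooth_real_on_def by presburger
qed

lemma smooth_real_on_const: "open S \<Longrightarrow> smooth_real_on S (\<lambda>t. c)"
  by (simp add: smooth_real_on_iff_diff_times diff_times_const)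

lemma smooth_real_on_id: "open S \<Longrightarrow> smooth_real_on S (\<lambda>t. t)"
  by (simp add: smooth_real_on_iff_diff_times diff_times_id)

lemma smooth_real_on_mult:
  "open S \<Longrightarrow> smooth_real_on S g \<Longrightarrow> smooth_real_on S h \<Longrightarrow> smooth_real_on S (\<lambda>t. g t * h t)"
  by (simp add: smooth_real_on_iff_diff_times diff_times_mult)

lemma smooth_real_on_sum:
  "open S \<Longrightarrow> (\<And>i. i \<in> I \<Longrightarrow> smooth_real_on S (g i)) \<Longrightarrow> smooth_real_on S (\<lambda>t. \<Sum>i\<in>I. g i t)"
  by (simp add: smooth_real_on_iff_diff_times diff_times_sum)

lemma smooth_real_on_power: "open S \<Longrightarrow> smooth_real_on S (\<lambda>t. t ^ n)"
  by (induction n) (simp_all add: smooth_real_on_const smooth_real_on_mult smooth_real_on_id)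

section \<open>Taylor coefficients of sums and products\<close>

lemma taylor_coeff_0: "taylor_coeff g 0 = g 0"
  by (simp add: taylor_coeff_def)

lemma taylor_coeff_cong:
  assumes "open S" "0 \<in> S" "\<And>t. t \<in> S \<Longrightarrow> g t = h t"
  shows "taylor_coeff g n = taylor_coeff h n"
proof -
  have "eventually (\<lambda>t. g t = h t) (nhds 0)"
    using assms eventually_nhds by blast
  then show ?thesis
    unfolding taylor_coeff_def by (simp add: higher_deriv_cong_ev)
qed

text \<open>
  With a derivative \<open>g'\<close> given by a formula near 0, this reads off a recursion for the Taylor
  coefficients from a differential equation.
\<close>

lemma taylor_coeff_Suc:
  assumes "open S" "0 \<in> S" "\<And>t. t \<in> S \<Longrightarrow> (g has_real_derivative g' t) (at t)"
  shows "taylor_coeff g (Suc n) = taylor_coeff g' n / real (Suc n)"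
proof -
  have "taylor_coeff (deriv g) n = taylor_coeff g' n"
    by (rule taylor_coeff_cong[OF assms(1,2)]) (rule DERIV_imp_deriv[OF assms(3)])
  then show ?thesis
    by (simp add: taylor_coeff_def funpow_Suc_right del: funpow.simps)
qed

lemma taylor_coeff_const: "taylor_coeff (\<lambda>t. c) n = (if n = 0 then c else 0)"
  by (induction n arbitrary: c)
    (auto simp: taylor_coeff_0 taylor_coeff_Suc[where S=UNIV and g'="\<lambda>t. 0"])

lemma taylor_coeff_add:
  assumes "open S" "0 \<in> S" "smooth_real_on S g" "smooth_real_on S h"
  shows "taylor_coeff (\<lambda>t. g t + h t) n = taylor_coeff g n + taylor_coeff h n"
  using assms(3,4)
proof (induction n arbitrary: g h)
  case (Suc n)
  note d = smooth_real_on_has_deriv[OF Suc.prems(1)] smooth_real_on_has_deriv[OF Suc.prems(2)]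
  have "taylor_coeff (\<lambda>t. g t + h t) (Suc n) = taylor_coeff (\<lambda>t. deriv g t + deriv h t) n / real (Suc n)"
    using assms(1,2) by (rule taylor_coeff_Suc) (intro DERIV_add d)
  also have "\<dots> = taylor_coeff (deriv g) n / real (Suc n) + taylor_coeff (deriv h) n / real (Suc n)"
    using Suc smooth_real_on_deriv by (simp add: add_divide_distrib)
  also have "\<dots> = taylor_coeff g (Suc n) + taylor_coeff h (Suc n)"
    using taylor_coeff_Suc[OF assms(1,2) d(1)] taylor_coeff_Suc[OF assms(1,2) d(2)] by simp
  finally show ?case .
qed (simp add: taylor_coeff_0)

lemma fps_deriv_taylor:
  assumes "open S" "0 \<in> S" "smooth_real_on S g"
  shows "fps_deriv (Abs_fps (taylor_coeff g)) = Abs_fps (taylor_coeff (deriv g))"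
  by (rule fps_ext)
    (use taylor_coeff_Suc[OF assms(1,2) smooth_real_on_has_deriv[OF assms(3)]] in simp)

text \<open>
  Both sides have the same constant term, and by Leibniz both are turned by \<^const>\<open>fps_deriv\<close> into the
  corresponding expression for \<open>g * h'\<close> and \<open>g' * h\<close>. Induction on the index of the coefficient, for all
  \<open>g\<close> and \<open>h\<close> at once, therefore needs no manipulation of the convolution sum.
\<close>

lemma taylor_fps_mult:
  assumes "open S" "0 \<in> S" "smooth_real_on S g" "smooth_real_on S h"
  shows "Abs_fps (taylor_coeff (\<lambda>t. g t * h t)) = Abs_fps (taylor_coeff g) * Abs_fps (taylor_coeff h)"
proof (rule fps_ext)
  fix n
  show "fps_nth (Abs_fps (taylor_coeff (\<lambda>t. g t * h t))) n =
    fps_nth (Abs_fps (taylor_coeff g) * Abs_fps (taylor_coeff h)) n"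
    using assms(3,4)
  proof (induction n arbitrary: g h)
    case (Suc n)
    note sm = Suc.prems smooth_real_on_deriv[OF Suc.prems(1)] smooth_real_on_deriv[OF Suc.prems(2)]
    note d = smooth_real_on_has_deriv[OF Suc.prems(1)] smooth_real_on_has_deriv[OF Suc.prems(2)]
    let ?P = "Abs_fps (taylor_coeff g)" and ?Q = "Abs_fps (taylor_coeff h)"
    have "real (Suc n) * taylor_coeff (\<lambda>t. g t * h t) (Suc n) =
        taylor_coeff (\<lambda>t. g t * deriv h t + deriv g t * h t) n"
      by (subst taylor_coeff_Suc[OF assms(1,2), where g' = "\<lambda>t. g t * deriv h t + deriv g t * h t"])
        (intro DERIV_mult' d, simp_all)
    also have "\<dots> = taylor_coeff (\<lambda>t. g t * deriv h t) n + taylor_coeff (\<lambda>t. deriv g t * h t) n"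
      using sm by (intro taylor_coeff_add[OF assms(1,2)] smooth_real_on_mult assms)
    also have "\<dots> = fps_nth (?P * fps_deriv ?Q + fps_deriv ?P * ?Q) n"
      using Suc.IH[OF sm(3,2)] Suc.IH[OF sm(1,4)]
      by (simp add: fps_deriv_taylor[OF assms(1,2)] sm)
    also have "\<dots> = real (Suc n) * fps_nth (?P * ?Q) (Suc n)"
      by (simp only: fps_deriv_mult[symmetric] fps_deriv_nth) simp
    finally show ?case
      by simp
  qed (simp add: taylor_coeff_0)
qed

lemma taylor_coeff_mult:
  assumes "open S" "0 \<in> S" "smooth_real_on S g" "smooth_real_on S h"
  shows "taylor_coeff (\<lambda>t. g t * h t) n = (\<Sum>r\<le>n. taylor_coeff g r * taylor_coeff h (n - r))"
  using arg_cong[OF taylor_fps_mult[OF assms], of "\<lambda>P. fps_nth P n"]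
  by (simp add: fps_mult_nth atLeast0AtMost)

lemma taylor_coeff_cmult:
  assumes "open S" "0 \<in> S" "smooth_real_on S g"
  shows "taylor_coeff (\<lambda>t. c * g t) n = c * taylor_coeff g n"
  using taylor_coeff_mult[OF assms(1,2) smooth_real_on_const[OF assms(1)] assms(3)]
  by (simp add: taylor_coeff_const if_distrib[of "\<lambda>x. x * _"] cong: if_cong)

lemma taylor_coeff_sum:
  assumes "open S" "0 \<in> S" "\<And>i. i \<in> I \<Longrightarrow> smooth_real_on S (g i)"
  shows "taylor_coeff (\<lambda>t. \<Sum>i\<in>I. g i t) n = (\<Sum>i\<in>I. taylor_coeff (g i) n)"
  using assms(3)
  by (induction I rule: infinite_finite_induct)
    (simp_all add: taylor_coeff_const taylor_coeff_add[OF assms(1,2)] smooth_real_on_sum[OF assms(1)])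

text \<open>
  This is the shape of the stage and update equations: the factor \<open>h\<close> makes the coefficient of order
  \<open>n + 1\<close> on the left depend only on coefficients of order \<open>n\<close> on the right.
\<close>

lemma taylor_coeff_shift:
  assumes "open S" "0 \<in> S" "smooth_real_on S g"
  shows "taylor_coeff (\<lambda>t. c + t * g t) (Suc n) = taylor_coeff g n"
proof -
  have id: "Abs_fps (taylor_coeff (\<lambda>t. t)) = fps_X"
  proof (rule fps_ext)
    show "fps_nth (Abs_fps (taylor_coeff (\<lambda>t. t))) k = fps_nth fps_X k" for k
      by (cases k)
        (simp_all add: taylor_coeff_0 taylor_coeff_Suc[where S=UNIV and g'="\<lambda>t. 1"] taylor_coeff_const)
  qed
  have "taylor_coeff (\<lambda>t. t * g t) (Suc n) = fps_nth (fps_X * Abs_fps (taylor_coeff g)) (Suc n)"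
    using taylor_fps_mult[OF assms(1,2) smooth_real_on_id[OF assms(1)] assms(3)] id
    by (metis fps_nth_Abs_fps)
  then show ?thesis
    using assms
    by (simp add: taylor_coeff_add[OF assms(1,2)] smooth_real_on_const smooth_real_on_mult
        smooth_real_on_id taylor_coeff_const)
qed

lemma taylor_coeff_monomial: "taylor_coeff (\<lambda>t. c * t ^ n) n = c"
proof (induction n arbitrary: c)
  case (Suc n)
  have "taylor_coeff (\<lambda>t. c * t ^ Suc n) (Suc n) = taylor_coeff (\<lambda>t. c * t ^ n) n"
    using taylor_coeff_shift[OF open_UNIV UNIV_I, of "\<lambda>t. c * t ^ n" 0 n]
    by (simp add: smooth_real_on_const smooth_real_on_mult smooth_real_on_power mult_ac)
  then show ?case using Suc by simp
qed (simp add: taylor_coeff_0)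

section \<open>Smooth functions along smooth curves\<close>

lemma C_class_partial_deriv:
  "\<forall>k. C_class d k F \<Longrightarrow> j < d \<Longrightarrow> \<forall>k. C_class d k (partial_deriv j F)"
  using C_class.simps(2) by blast

lemma continuous_map_Rn_iff_continuous_on:
  "continuous_map (Euclidean_space d) euclideanreal G \<longleftrightarrow> continuous_on (Rn d) G"
  by (simp add: Euclidean_space_def euclidean_product_topology)

lemma fun_upd_Rn: "x \<in> Rn d \<Longrightarrow> j < d \<Longrightarrow> x(j := t) \<in> Rn d"
  by (auto simp: topspace_Euclidean_space)

text \<open>
  The topology of \<^const>\<open>Euclidean_space\<close> is that of pointwise convergence, so continuity can be tested on
  coordinates.
\<close>

lemma tendsto_Rn:
  assumes "continuous_map (Euclidean_space d) euclideanreal G" "p \<in> Rn d" "\<And>t. P t \<in> Rn d"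
    and "\<And>k. k < d \<Longrightarrow> ((\<lambda>t. P t k) \<longlongrightarrow> p k) A"
  shows "((\<lambda>t. G (P t)) \<longlongrightarrow> G p) A"
proof -
  have "((\<lambda>t. P t k) \<longlongrightarrow> p k) A" for k
    using assms(2-4) by (cases "k < d") (auto simp: topspace_Euclidean_space)
  then have "(P \<longlongrightarrow> p) A"
    using limitin_componentwise[of "\<lambda>_. euclideanreal" UNIV P p A]
    by (simp flip: euclidean_product_topology limitin_canonical_iff)
  then show ?thesis
    using assms(1-3) continuous_on_tendsto_compose[of "Rn d" G P p A]
    by (simp add: continuous_map_Rn_iff_continuous_on)
qed

lemma has_partial_deriv:
  assumes "C_class d (Suc 0) F" "j < d" "x \<in> Rn d"
  shows "((\<lambda>t. F (x(j := t))) has_real_derivative partial_deriv j F (x(j := \<xi>))) (at \<xi>)"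
proof -
  have "(\<lambda>t. F ((x(j := \<xi>))(j := t))) differentiable (at ((x(j := \<xi>)) j))"
    using assms fun_upd_Rn unfolding C_class.simps by blast
  then show ?thesis
    by (simp add: partial_deriv_def DERIV_deriv_iff_real_differentiable)
qed

lemma partial_mean_value:
  assumes "C_class d (Suc 0) F" "j < d" "x \<in> Rn d"
  shows "\<exists>\<xi>. \<bar>\<xi> - r\<bar> \<le> \<bar>t - r\<bar> \<and>
    F (x(j := t)) - F (x(j := r)) = partial_deriv j F (x(j := \<xi>)) * (t - r)"
proof (cases t r rule: linorder_cases)
  case less
  then obtain z where "t < z" "z < r"
      "F (x(j := r)) - F (x(j := t)) = (r - t) * partial_deriv j F (x(j := z))"
    using MVT2[of t r "\<lambda>t. F (x(j := t))" "\<lambda>z. partial_deriv j F (x(j := z))"]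
      has_partial_deriv[OF assms] by blast
  then show ?thesis by (intro exI[of _ z]) (auto simp: algebra_simps)
next
  case greater
  then obtain z where "r < z" "z < t"
      "F (x(j := t)) - F (x(j := r)) = (t - r) * partial_deriv j F (x(j := z))"
    using MVT2[of r t "\<lambda>t. F (x(j := t))" "\<lambda>z. partial_deriv j F (x(j := z))"]
      has_partial_deriv[OF assms] by blast
  then show ?thesis by (intro exI[of _ z]) (auto simp: algebra_simps)
qed auto

text \<open>
  Continuous partial derivatives suffice for the chain rule: one moves from \<open>x t\<^sub>0\<close> to \<open>x t\<close> by changing the
  coordinates one after the other, applies the mean value theorem to each change, and lets \<open>t\<close> tend
  to \<open>t\<^sub>0\<close>; all intermediate points then tend to \<open>x t\<^sub>0\<close>.
\<close>

lemma chain_rule_Rn: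
  assumes F: "C_class d (Suc 0) F" and x: "\<And>t. t \<in> S \<Longrightarrow> x t \<in> Rn d"
    and S: "open S" "t\<^sub>0 \<in> S"
    and x': "\<And>j. j < d \<Longrightarrow> ((\<lambda>t. x t j) has_real_derivative x' j) (at t\<^sub>0)"
  shows "((\<lambda>t. F (x t)) has_real_derivative (\<Sum>j<d. partial_deriv j F (x t\<^sub>0) * x' j)) (at t\<^sub>0)"
proof -
  define p where "p = x t\<^sub>0"
  have p: "p \<in> Rn d"
    using x S p_def by blast
  \<comment> \<open>the first \<open>j\<close> coordinates are already moved to \<open>x t\<close>\<close>
  define M where "M j t = (\<lambda>k. if k < j then x t k else p k)" for j t
  have ev: "eventually (\<lambda>t. t \<in> S) (at t\<^sub>0)"
    using S eventually_at_topological by blast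
  have lim_x: "((\<lambda>t. x t j) \<longlongrightarrow> p j) (at t\<^sub>0)" if "j < d" for j
    using DERIV_isCont[OF x'[OF that]] by (simp add: isCont_def p_def)
  have M: "M j t \<in> Rn d" if "j \<le> d" for j t
    using that p by (auto simp: M_def topspace_Euclidean_space)
  have M_Suc: "M (Suc j) t = (M j t)(j := x t j)" and M_same: "M j t = (M j t)(j := p j)" for j t
    by (auto simp: M_def fun_eq_iff)
  have step: "((\<lambda>t. (F (M (Suc j) t) - F (M j t)) / (t - t\<^sub>0)) \<longlongrightarrow> partial_deriv j F p * x' j) (at t\<^sub>0)"
    if j: "j < d" for j
  proof -
    have "\<forall>t. \<exists>\<xi>. \<bar>\<xi> - p j\<bar> \<le> \<bar>x t j - p j\<bar> \<and>
        F (M (Suc j) t) - F (M j t) = partial_deriv j F ((M j t)(j := \<xi>)) * (x t j - p j)"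
      using partial_mean_value[OF F j M, where r = "p j"] j M_Suc M_same
      by (metis less_imp_le)
    then obtain \<xi> where \<xi>: "\<And>t. \<bar>\<xi> t - p j\<bar> \<le> \<bar>x t j - p j\<bar>"
        "\<And>t. F (M (Suc j) t) - F (M j t) = partial_deriv j F ((M j t)(j := \<xi> t)) * (x t j - p j)"
      by metis
    have "((\<lambda>t. \<xi> t - p j) \<longlongrightarrow> 0) (at t\<^sub>0)"
      using LIM_zero[OF lim_x[OF j]] by (rule Lim_null_comparison[rotated, OF tendsto_norm_zero]) (simp add: \<xi>)
    then have "(\<xi> \<longlongrightarrow> p j) (at t\<^sub>0)"
      by (rule LIM_zero_cancel)
    moreover have "((\<lambda>t. M j t k) \<longlongrightarrow> p k) (at t\<^sub>0)" if "k < d" for k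
      using lim_x[OF that] by (cases "k < j") (auto simp: M_def)
    ultimately have lim: "((\<lambda>t. ((M j t)(j := \<xi> t)) k) \<longlongrightarrow> p k) (at t\<^sub>0)" if "k < d" for k
      using that by (cases "k = j") auto
    have cont: "continuous_map (Euclidean_space d) euclideanreal (partial_deriv j F)"
      using F j by simp
    have "((\<lambda>t. partial_deriv j F ((M j t)(j := \<xi> t))) \<longlongrightarrow> partial_deriv j F p) (at t\<^sub>0)"
      by (rule tendsto_Rn[OF cont p fun_upd_Rn[OF M[OF less_imp_le[OF j]] j] lim])
    moreover have "((\<lambda>t. (x t j - p j) / (t - t\<^sub>0)) \<longlongrightarrow> x' j) (at t\<^sub>0)"
      using x'[OF j] by (simp add: has_field_derivative_iff p_def)
    ultimately have "((\<lambda>t. partial_deriv j F ((M j t)(j := \<xi> t)) * ((x t j - p j) / (t - t\<^sub>0)))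
        \<longlongrightarrow> partial_deriv j F p * x' j) (at t\<^sub>0)"
      by (rule tendsto_mult)
    then show ?thesis
      by (simp add: \<xi>(2))
  qed
  have "((\<lambda>t. \<Sum>j<d. (F (M (Suc j) t) - F (M j t)) / (t - t\<^sub>0)) \<longlongrightarrow> (\<Sum>j<d. partial_deriv j F p * x' j)) (at t\<^sub>0)"
    by (intro tendsto_sum) (use step in simp)
  moreover have "eventually (\<lambda>t. (\<Sum>j<d. (F (M (Suc j) t) - F (M j t)) / (t - t\<^sub>0))
      = (F (x t) - F (x t\<^sub>0)) / (t - t\<^sub>0)) (at t\<^sub>0)"
    using ev
  proof eventually_elim
    case (elim t)
    have "M d t = x t"
      using x[OF elim] p by (auto simp: M_def fun_eq_iff topspace_Euclidean_space)
    moreover have "M 0 t = x t\<^sub>0"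
      by (simp add: M_def p_def)
    ultimately show ?case
      using sum_lessThan_telescope[of "\<lambda>j. F (M j t)" d] by (simp flip: sum_divide_distrib)
  qed
  ultimately have "((\<lambda>t. (F (x t) - F (x t\<^sub>0)) / (t - t\<^sub>0)) \<longlongrightarrow> (\<Sum>j<d. partial_deriv j F p * x' j)) (at t\<^sub>0)"
    by (rule Lim_transform_eventually)
  then show ?thesis
    by (simp add: has_field_derivative_iff p_def)
qed

lemma diff_times_compose:
  assumes S: "open S" and x: "\<And>t. t \<in> S \<Longrightarrow> x t \<in> Rn d"
    and "\<forall>k. C_class d k F" "\<And>j. j < d \<Longrightarrow> diff_times n S (\<lambda>t. x t j)"
  shows "diff_times n S (\<lambda>t. F (x t))"
  using assms(3,4)
proof (induction n arbitrary: F)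
  case (Suc n)
  obtain x' where x': "\<And>j. j < d \<Longrightarrow> \<forall>t\<in>S. ((\<lambda>t. x t j) has_real_derivative x' j t) (at t)"
      "\<And>j. j < d \<Longrightarrow> diff_times n S (x' j)"
    using Suc.prems(2) unfolding diff_times.simps by metis
  have "((\<lambda>t. F (x t)) has_real_derivative (\<Sum>j<d. partial_deriv j F (x t) * x' j t)) (at t)"
    if "t \<in> S" for t
    using x'(1) that by (intro chain_rule_Rn[OF spec[OF Suc.prems(1)] x S]) auto
  moreover have "diff_times n S (\<lambda>t. \<Sum>j<d. partial_deriv j F (x t) * x' j t)"
  proof (intro diff_times_sum diff_times_mult)
    fix j assume j: "j \<in> {..<d}"
    then have "\<forall>k. C_class d k (partial_deriv j F)"
      using Suc.prems(1) by (intro C_class_partial_deriv) auto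
    then show "diff_times n S (\<lambda>t. partial_deriv j F (x t))"
      by (rule Suc.IH) (rule diff_times_pred, rule Suc.prems(2))
    show "diff_times n S (x' j)"
      using j x' by simp
  qed
  ultimately show ?case
    unfolding diff_times.simps by (intro exI conjI ballI)
qed simp

lemma smooth_real_on_compose:
  assumes S: "open S" and x: "\<And>t. t \<in> S \<Longrightarrow> x t \<in> Rn d"
    and "\<forall>k. C_class d k F" "\<And>j. j < d \<Longrightarrow> smooth_real_on S (\<lambda>t. x t j)"
  shows "smooth_real_on S (\<lambda>t. F (x t))"
  using assms(4) diff_times_compose[OF assms(1-3)]
  by (simp add: smooth_real_on_iff_diff_times[OF S])

text \<open>
  The chain rule followed by the product rule, coefficient by coefficient. As \<open>r \<le> n\<close>, the right-hand side
  involves \<open>F\<close> only through lower coefficients of its partial derivatives: iterated, the recursion yields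
  the formula of Faa di Bruno.
\<close>

lemma taylor_coeff_compose_Suc:
  assumes S: "open S" "0 \<in> S" and x: "\<And>t. t \<in> S \<Longrightarrow> x t \<in> Rn d"
    and F: "\<forall>k. C_class d k F" and sm: "\<And>j. j < d \<Longrightarrow> smooth_real_on S (\<lambda>t. x t j)"
  shows "taylor_coeff (\<lambda>t. F (x t)) (Suc n) =
    (\<Sum>j<d. \<Sum>r\<le>n. real (Suc (n - r)) / real (Suc n) *
       (taylor_coeff (\<lambda>t. partial_deriv j F (x t)) r * taylor_coeff (\<lambda>t. x t j) (Suc (n - r))))"
proof -
  let ?x' = "\<lambda>j. deriv (\<lambda>t. x t j)"
  note dx = smooth_real_on_has_deriv[OF sm] and sx' = smooth_real_on_deriv[OF sm]
  have sp: "smooth_real_on S (\<lambda>t. partial_deriv j F (x t))" if "j < d" for j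
    by (rule smooth_real_on_compose[OF S(1) x C_class_partial_deriv[OF F that] sm])
  have "taylor_coeff (\<lambda>t. F (x t)) (Suc n) =
      taylor_coeff (\<lambda>t. \<Sum>j<d. partial_deriv j F (x t) * ?x' j t) n / real (Suc n)"
    by (intro taylor_coeff_Suc[OF S] chain_rule_Rn[OF spec[OF F] x S(1)] dx)
  also have "taylor_coeff (\<lambda>t. \<Sum>j<d. partial_deriv j F (x t) * ?x' j t) n =
      (\<Sum>j<d. taylor_coeff (\<lambda>t. partial_deriv j F (x t) * ?x' j t) n)"
    by (intro taylor_coeff_sum[OF S] smooth_real_on_mult[OF S(1)] sp sx') auto
  also have "\<dots> = (\<Sum>j<d. \<Sum>r\<le>n. taylor_coeff (\<lambda>t. partial_deriv j F (x t)) r * taylor_coeff (?x' j) (n - r))"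
    by (intro sum.cong refl taylor_coeff_mult[OF S] sp sx') auto
  also have "\<dots> = (\<Sum>j<d. \<Sum>r\<le>n. taylor_coeff (\<lambda>t. partial_deriv j F (x t)) r *
      (real (Suc (n - r)) * taylor_coeff (\<lambda>t. x t j) (Suc (n - r))))"
    using taylor_coeff_Suc[OF S dx] by (intro sum.cong refl) simp
  finally show ?thesis
    by (simp only: sum_divide_distrib) (simp add: mult_ac)
qed

section \<open>Recursive form of the tree conditions\<close>

lemma Nil_in_verts: "[] \<in> verts u"
  by (simp add: verts_def)

lemma Cons_in_verts:
  "x # v \<in> verts u \<longleftrightarrow> snd x < count (subtrees u) (fst x) \<and> v \<in> verts (fst x)"
  by (cases x) (simp add: verts_def)

lemma colour_Nil: "colour u [] = root_colour u"
  by (simp add: colour_def)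

lemma colour_Cons: "colour u (x # v) = colour (fst x) v"
  by (simp add: colour_def)

text \<open>
  The possible first steps of a path from the root, one for each subtree counted with multiplicity.
  Working with this set turns sums and products over vertices into sums and products over the
  multiset of subtrees.
\<close>

definition child_slots :: "ntree multiset \<Rightarrow> (ntree \<times> nat) set" where
  "child_slots us = (SIGMA w:set_mset us. {..<count us w})"

lemma finite_child_slots: "finite (child_slots us)"
  by (simp add: child_slots_def)

lemma mem_child_slots: "x \<in> child_slots us \<longleftrightarrow> snd x < count us (fst x)"
  by (cases x) (auto simp: child_slots_def simp flip: count_greater_zero_iff)

lemma image_mset_child_slots: "image_mset fst (mset_set (child_slots us)) = us"
proof (rule multiset_eqI)
  fix w
  have "fst -` {w} \<inter> child_slots us = Pair w ` {..<count us w}"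
    by (auto simp: mem_child_slots)
  then have "(\<Sum>x\<in>fst -` {w} \<inter> child_slots us. count (mset_set (child_slots us)) x) = count us w"
    by (simp add: finite_child_slots mem_child_slots sum.reindex inj_on_def card_image)
  then show "count (image_mset fst (mset_set (child_slots us))) w = count us w"
    by (simp add: count_image_mset finite_child_slots)
qed

lemma fst_image_child_slots: "fst ` child_slots us = set_mset us"
  using arg_cong[OF image_mset_child_slots[of us], of set_mset] by (simp add: finite_child_slots)

lemma prod_child_slots: "(\<Prod>x\<in>child_slots us. f (fst x)) = (\<Prod>w\<in>#us. f w)"
proof -
  have "(\<Prod>x\<in>child_slots us. f (fst x)) = (\<Prod>w\<in>#image_mset fst (mset_set (child_slots us)). f w)"
    by (simp add: prod_unfold_prod_mset image_mset.compositionality o_def)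
  then show ?thesis by (simp add: image_mset_child_slots)
qed

lemma sum_child_slots: "(\<Sum>x\<in>child_slots us. f (fst x)) = (\<Sum>w\<in>#us. f w)"
proof -
  have "(\<Sum>x\<in>child_slots us. f (fst x)) = (\<Sum>w\<in>#image_mset fst (mset_set (child_slots us)). f w)"
    by (simp add: sum_unfold_sum_mset image_mset.compositionality o_def)
  then show ?thesis by (simp add: image_mset_child_slots)
qed

lemma verts_Node_child_slots:
  "verts (Node m us) = insert [] (\<Union>x\<in>child_slots us. (#) x ` verts (fst x))"
proof -
  have "v \<in> verts (Node m us) \<longleftrightarrow> v \<in> insert [] (\<Union>x\<in>child_slots us. (#) x ` verts (fst x))" for v
    by (cases v) (auto simp: Nil_in_verts Cons_in_verts mem_child_slots)
  then show ?thesis by blast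
qed

lemma num_verts_Node: "num_verts (Node m us) = Suc (\<Sum>w\<in>#us. num_verts w)"
proof -
  have "card (\<Union>x\<in>child_slots us. (#) x ` verts (fst x)) = (\<Sum>x\<in>child_slots us. card ((#) x ` verts (fst x)))"
    by (intro card_UN_disjoint) (auto simp: finite_child_slots finite_verts)
  also have "\<dots> = (\<Sum>x\<in>child_slots us. num_verts (fst x))"
    by (simp add: num_verts_def card_image)
  also have "\<dots> = (\<Sum>w\<in>#us. num_verts w)"
    by (rule sum_child_slots)
  finally show ?thesis
    unfolding num_verts_def verts_Node_child_slots
    by (subst card_insert_disjoint) (auto simp: finite_child_slots finite_verts num_verts_def)
qed

lemma num_verts_pos: "0 < num_verts u"
  by (cases u) (simp add: num_verts_Node)

lemma is_Ntree_Node: "is_Ntree N (Node m us) \<longleftrightarrow> m \<in> {1..N} \<and> (\<forall>w\<in>#us. is_Ntree N w)"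
proof -
  have "is_Ntree N (Node m us) \<longleftrightarrow> m \<in> {1..N} \<and> (\<forall>x\<in>child_slots us. is_Ntree N (fst x))"
    unfolding is_Ntree_def verts_Node_child_slots by (auto simp: colour_Nil colour_Cons)
  also have "(\<forall>x\<in>child_slots us. is_Ntree N (fst x)) \<longleftrightarrow> (\<forall>w\<in>#us. is_Ntree N w)"
    by (simp flip: fst_image_child_slots)
  finally show ?thesis .
qed

lemma one_divide_prod_mset:
  "1 / real (\<Prod>w\<in>#us. f w) = (\<Prod>w\<in>#us. 1 / real (f w))"
  by (induction us) (simp_all add: divide_inverse)

lemma one_divide_tree_density_Node:
  "1 / real (tree_density (Node m us)) =
     (\<Prod>w\<in>#us. 1 / real (tree_density w)) / real (num_verts (Node m us))"
  using one_divide_prod_mset[of tree_density us] by (simp add: divide_inverse mult.commute)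

text \<open>
  The elementary weight of a tree, with the coefficients at the root left open as \<open>g\<close>: taking
  \<open>g = b\<close> gives the left-hand side of an order condition, and taking \<open>g = a q \<cdot> i \<cdot>\<close> gives
  the weight of the tree for the stage \<open>i\<close> of colour \<open>q\<close>. With \<open>g\<close> as an argument one recursion covers both.
\<close>

primrec tree_weight ::
  "(nat \<Rightarrow> nat) \<Rightarrow> (nat \<Rightarrow> nat \<Rightarrow> nat \<Rightarrow> nat \<Rightarrow> real) \<Rightarrow> ntree \<Rightarrow> (nat \<Rightarrow> nat \<Rightarrow> real) \<Rightarrow> real" where
  "tree_weight s a (Node m us) = (\<lambda>g. \<Sum>j=1..s m.
     g m j * (\<Prod>\<^sub># (image_mset (\<lambda>w. w (\<lambda>m'. a m m' j)) (image_mset (tree_weight s a) us))))"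

lemma tree_weight_Node:
  "tree_weight s a (Node m us) g = (\<Sum>j=1..s m. g m j * (\<Prod>w\<in>#us. tree_weight s a w (\<lambda>m'. a m m' j)))"
  by (simp add: image_mset.compositionality o_def)

declare tree_weight.simps [simp del]

lemma edges_subset: "edges u \<subseteq> verts u \<times> verts u"
  by (auto simp: edges_def)

lemma edges_Node:
  "edges (Node m us) =
     (\<Union>x\<in>child_slots us. insert ([], [x]) ((\<lambda>(v, w). (x # v, x # w)) ` edges (fst x)))"
proof -
  have "(v, v @ [y]) \<in> edges (Node m us) \<longleftrightarrow>
      (v, v @ [y]) \<in> (\<Union>x\<in>child_slots us. insert ([], [x]) ((\<lambda>(v, w). (x # v, x # w)) ` edges (fst x)))"
    for v y
    by (cases v; cases y) (auto simp: edges_def Nil_in_verts Cons_in_verts mem_child_slots image_iff)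
  moreover have "e \<in> edges (Node m us) \<Longrightarrow> \<exists>v y. e = (v, v @ [y])" for e
    by (auto simp: edges_def)
  moreover have "e \<in> (\<Union>x\<in>child_slots us. insert ([], [x]) ((\<lambda>(v, w). (x # v, x # w)) ` edges (fst x)))
      \<Longrightarrow> \<exists>v y. e = (v, v @ [y])" for e
    by (auto simp: edges_def)
  ultimately show ?thesis by (metis (no_types, lifting) subsetI subset_antisym)
qed

lemma prod_edges_Node:
  "(\<Prod>e\<in>edges (Node m us). h e) =
     (\<Prod>x\<in>child_slots us. h ([], [x]) * (\<Prod>(v, w)\<in>edges (fst x). h (x # v, x # w)))"
proof -
  have fin: "finite (edges u)" for u
    using finite_subset[OF edges_subset] finite_verts by blast
  have "(\<Prod>e\<in>insert ([], [x]) ((\<lambda>(v, w). (x # v, x # w)) ` edges (fst x)). h e) =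
      h ([], [x]) * (\<Prod>(v, w)\<in>edges (fst x). h (x # v, x # w))" for x
  proof -
    have inj: "inj_on (\<lambda>(v, w). (x # v, x # w)) (edges (fst x))"
      by (auto simp: inj_on_def)
    have "prod h ((\<lambda>(v, w). (x # v, x # w)) ` edges (fst x)) = (\<Prod>(v, w)\<in>edges (fst x). h (x # v, x # w))"
      unfolding prod.reindex[OF inj] by (intro prod.cong) auto
    then show ?thesis
      by (subst prod.insert) (auto simp: fin)
  qed
  then show ?thesis
    unfolding edges_Node
    by (subst prod.UNION_disjoint) (auto simp: fin finite_child_slots)
qed

text \<open>
  An assignment of indices to the vertices of \<open>[u\<^sub>1, \<dots>, u\<^sub>k]\<close> is an index for the root together with
  assignments for \<open>u\<^sub>1, \<dots>, u\<^sub>k\<close>. Every edge lies in one \<open>u\<^sub>j\<close> or joins the root to the root of one \<open>u\<^sub>j\<close>, so for a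
  fixed root index the summand is a product over the subtrees, and the sum of products is a product
  of sums.
\<close>

lemma sum_over_index_assignments:
  "(\<Sum>\<iota> \<in> (\<Pi>\<^sub>E v\<in>verts u. {1..s (colour u v)}).
      g (colour u []) (\<iota> []) *
      (\<Prod>(v, w)\<in>edges u. a (colour u v) (colour u w) (\<iota> v) (\<iota> w))) = tree_weight s a u g"
proof (induction u arbitrary: g)
  case (Node m us)
  let ?u = "Node m us" and ?I = "child_slots us"
  define A where "A w = (\<Pi>\<^sub>E v\<in>verts w. {1..s (colour w v)})" for w
  define W where "W w i \<iota> = a m (colour w []) i (\<iota> []) *
      (\<Prod>(v, v')\<in>edges w. a (colour w v) (colour w v') (\<iota> v) (\<iota> v'))" for w i \<iota>
  have W_cong: "W w i \<iota> = W w i \<kappa>" if "\<And>v. v \<in> verts w \<Longrightarrow> \<iota> v = \<kappa> v" for w i \<iota> \<kappa>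
  proof -
    have "(\<Prod>(v, v')\<in>edges w. a (colour w v) (colour w v') (\<iota> v) (\<iota> v')) =
        (\<Prod>(v, v')\<in>edges w. a (colour w v) (colour w v') (\<kappa> v) (\<kappa> v'))"
      by (intro prod.cong) (auto dest!: subsetD[OF edges_subset] simp: that)
    then show ?thesis
      by (simp add: W_def that[OF Nil_in_verts])
  qed
  have finA: "finite (A w)" for w
    unfolding A_def by (intro finite_PiE) (auto simp: finite_verts)
  \<comment> \<open>cutting an assignment at the root, and gluing the pieces together again\<close>
  let ?split = "\<lambda>\<iota>. (\<iota> [], \<lambda>x\<in>?I. \<lambda>v\<in>verts (fst x). \<iota> (x # v))"
  let ?join = "\<lambda>(i, \<kappa>). \<lambda>v\<in>verts ?u. case v of [] \<Rightarrow> i | x # v' \<Rightarrow> \<kappa> x v'"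
  have "(\<Sum>\<iota>\<in>A ?u. g (colour ?u []) (\<iota> []) *
      (\<Prod>(v, w)\<in>edges ?u. a (colour ?u v) (colour ?u w) (\<iota> v) (\<iota> w))) =
      (\<Sum>\<iota>\<in>A ?u. g m (\<iota> []) * (\<Prod>x\<in>?I. W (fst x) (\<iota> []) (\<lambda>v. \<iota> (x # v))))"
    by (simp add: prod_edges_Node W_def colour_Nil colour_Cons)
  also have "\<dots> = (\<Sum>(i, \<kappa>)\<in>{1..s m} \<times> (\<Pi>\<^sub>E x\<in>?I. A (fst x)). g m i * (\<Prod>x\<in>?I. W (fst x) i (\<kappa> x)))"
  proof (rule sum.reindex_bij_witness[where i = ?join and j = ?split])
    fix \<iota> assume \<iota>: "\<iota> \<in> A ?u"
    show "?join (?split \<iota>) = \<iota>"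
    proof
      fix v
      show "?join (?split \<iota>) v = \<iota> v"
      proof (cases "v \<in> verts ?u")
        case True
        then show ?thesis
          by (cases v) (simp_all add: Cons_in_verts mem_child_slots)
      next
        case False
        then show ?thesis
          using PiE_arb[OF \<iota>[unfolded A_def]] by simp
      qed
    qed
    have "(\<lambda>v\<in>verts (fst x). \<iota> (x # v)) \<in> A (fst x)" if x: "x \<in> ?I" for x
      unfolding A_def
    proof (rule PiE_I)
      fix v assume v: "v \<in> verts (fst x)"
      then have "x # v \<in> verts ?u"
        using x by (simp add: Cons_in_verts mem_child_slots)
      from PiE_mem[OF \<iota>[unfolded A_def] this]
      show "(\<lambda>v\<in>verts (fst x). \<iota> (x # v)) v \<in> {1..s (colour (fst x) v)}"
        using v by (simp add: colour_Cons)
    qed simp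
    moreover have "\<iota> [] \<in> {1..s m}"
      using PiE_mem[OF \<iota>[unfolded A_def] Nil_in_verts] by (simp add: colour_Nil)
    ultimately show "?split \<iota> \<in> {1..s m} \<times> (\<Pi>\<^sub>E x\<in>?I. A (fst x))"
      by (simp add: restrict_PiE_iff)
    have "(\<Prod>x\<in>?I. W (fst x) (\<iota> []) (\<lambda>v. \<iota> (x # v))) =
        (\<Prod>x\<in>?I. W (fst x) (\<iota> []) (\<lambda>v\<in>verts (fst x). \<iota> (x # v)))"
      by (intro prod.cong W_cong) auto
    then show "(case ?split \<iota> of (i, \<kappa>) \<Rightarrow> g m i * (\<Prod>x\<in>?I. W (fst x) i (\<kappa> x))) =
        g m (\<iota> []) * (\<Prod>x\<in>?I. W (fst x) (\<iota> []) (\<lambda>v. \<iota> (x # v)))"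
      by simp
  next
    fix i\<kappa> assume i\<kappa>: "i\<kappa> \<in> {1..s m} \<times> (\<Pi>\<^sub>E x\<in>?I. A (fst x))"
    then obtain i \<kappa> where ik: "i\<kappa> = (i, \<kappa>)" "i \<in> {1..s m}" "\<kappa> \<in> (\<Pi>\<^sub>E x\<in>?I. A (fst x))"
      by blast
    have arb: "\<kappa> x v = undefined" if "x \<in> ?I" "v \<notin> verts (fst x)" for x v
      using PiE_mem[OF ik(3) that(1)] that(2) unfolding A_def by (rule PiE_arb)
    have "(\<lambda>x\<in>?I. \<lambda>v\<in>verts (fst x). ?join i\<kappa> (x # v)) = \<kappa>"
    proof (intro ext)
      fix x v
      show "(\<lambda>x\<in>?I. \<lambda>v\<in>verts (fst x). ?join i\<kappa> (x # v)) x v = \<kappa> x v"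
        using arb[of x v] PiE_arb[OF ik(3), of x]
        by (cases "x \<in> ?I") (auto simp: ik Cons_in_verts mem_child_slots)
    qed
    then show "?split (?join i\<kappa>) = i\<kappa>"
      by (simp add: ik Nil_in_verts)
    have mem: "\<kappa> x v \<in> {1..s (colour (fst x) v)}" if "x \<in> ?I" "v \<in> verts (fst x)" for x v
      using PiE_mem[OF ik(3) that(1)] that(2) unfolding A_def by (rule PiE_mem)
    show "?join i\<kappa> \<in> A ?u"
      unfolding A_def
    proof (rule PiE_I)
      fix v assume "v \<in> verts ?u"
      then show "?join i\<kappa> v \<in> {1..s (colour ?u v)}"
        using ik(2) mem by (cases v) (auto simp: ik(1) colour_Nil colour_Cons Cons_in_verts mem_child_slots)
    qed (simp add: ik)
  qed
  also have "\<dots> = (\<Sum>i=1..s m. g m i * (\<Sum>\<kappa>\<in>(\<Pi>\<^sub>E x\<in>?I. A (fst x)). \<Prod>x\<in>?I. W (fst x) i (\<kappa> x)))"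
    by (simp add: sum.cartesian_product[symmetric] sum_distrib_left)
  also have "\<dots> = (\<Sum>i=1..s m. g m i * (\<Prod>x\<in>?I. \<Sum>\<kappa>\<in>A (fst x). W (fst x) i \<kappa>))"
    by (simp add: prod_sum_PiE finite_child_slots finA)
  also have "\<dots> = (\<Sum>i=1..s m. g m i * (\<Prod>x\<in>?I. tree_weight s a (fst x) (\<lambda>m'. a m m' i)))"
  proof (intro sum.cong prod.cong arg_cong2[where f = "(*)"] refl)
    fix i x assume "x \<in> ?I"
    then have "fst x \<in># us" by (auto simp: child_slots_def)
    from Node[OF this, of "\<lambda>m'. a m m' i"]
    show "(\<Sum>\<kappa>\<in>A (fst x). W (fst x) i \<kappa>) = tree_weight s a (fst x) (\<lambda>m'. a m m' i)"
      by (simp add: A_def W_def)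
  qed
  also have "\<dots> = tree_weight s a ?u g"
    by (simp add: tree_weight_Node prod_child_slots[of "\<lambda>w. tree_weight s a w _"])
  finally show ?case
    by (simp add: A_def)
qed

section \<open>Taylor coefficients as universal tree expressions\<close>

text \<open>
  The Taylor coefficient of order \<open>n\<close> of \<open>F \<circ> x\<close> as an expression in an unknown function \<open>\<psi>\<close> of forests with \<open>n\<close>
  vertices, for a curve \<open>x\<close> starting at \<open>yn\<close>. It is linear in \<open>\<psi>\<close>, with coefficients built, like
  elementary differentials, from the partial derivatives of \<open>f\<close> and \<open>F\<close> at \<open>yn\<close>. The recursion is that of
  \<open>taylor_coeff_compose_Suc\<close>: the coefficient of \<open>x\<^sub>j\<close> of order \<open>n - r + 1\<close> that occurs there is itself to be
  expanded in trees \<open>Node m V\<close> with \<open>V\<close> a forest of \<open>n - r\<close> vertices, and the two linear expressions are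
  multiplied by joining the tree to the forest \<open>U\<close> obtained from the other factor.
\<close>

function tree_expansion ::
  "nat \<Rightarrow> nat \<Rightarrow> (nat \<Rightarrow> (nat \<Rightarrow> real) \<Rightarrow> (nat \<Rightarrow> real)) \<Rightarrow> (nat \<Rightarrow> real) \<Rightarrow>
   ((nat \<Rightarrow> real) \<Rightarrow> real) \<Rightarrow> nat \<Rightarrow> (ntree multiset \<Rightarrow> real) \<Rightarrow> real" where
  "tree_expansion d N f yn F 0 \<psi> = F yn * \<psi> {#}"
| "tree_expansion d N f yn F (Suc n) \<psi> =
     (\<Sum>j<d. \<Sum>r\<le>n. real (Suc (n - r)) / real (Suc n) *
        tree_expansion d N f yn (partial_deriv j F) r
          (\<lambda>U. \<Sum>m=1..N. tree_expansion d N f yn (\<lambda>x. f m x j) (n - r)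
             (\<lambda>V. \<psi> (add_mset (Node m V) U))))"
  by pat_completeness auto
termination
  by (relation "Wellfounded.measure (\<lambda>(d, N, f, yn, F, n, \<psi>). n)") auto

declare tree_expansion.simps(2) [simp del]

text \<open>
  Every forest at which the recursion evaluates \<open>\<psi>\<close> is made of \<open>N\<close>-trees and has \<open>n\<close> vertices. This is
  how the bound on the number of vertices enters the order conditions.
\<close>

lemma tree_expansion_cong:
  assumes "\<And>U. (\<forall>u\<in>#U. is_Ntree N u) \<Longrightarrow> (\<Sum>u\<in>#U. num_verts u) = n \<Longrightarrow> \<psi> U = \<xi> U"
  shows "tree_expansion d N f yn F n \<psi> = tree_expansion d N f yn F n \<xi>"
  using assms
proof (induction n arbitrary: F \<psi> \<xi> rule: less_induct)
  case (less n)
  show ?case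
  proof (cases n)
    case 0
    then show ?thesis using less.prems[of "{#}"] by simp
  next
    case (Suc n')
    show ?thesis
      unfolding Suc tree_expansion.simps(2)
    proof (intro sum.cong refl arg_cong2[where f = "(*)"])
      fix j r assume r: "r \<in> {..n'}"
      show "tree_expansion d N f yn (partial_deriv j F) r
          (\<lambda>U. \<Sum>m=1..N. tree_expansion d N f yn (\<lambda>x. f m x j) (n' - r) (\<lambda>V. \<psi> (add_mset (Node m V) U))) =
        tree_expansion d N f yn (partial_deriv j F) r
          (\<lambda>U. \<Sum>m=1..N. tree_expansion d N f yn (\<lambda>x. f m x j) (n' - r) (\<lambda>V. \<xi> (add_mset (Node m V) U)))"
      proof (rule less.IH)
        show "r < n" using r Suc by simp
        fix U assume U: "\<forall>u\<in>#U. is_Ntree N u" "(\<Sum>u\<in>#U. num_verts u) = r"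
        show "(\<Sum>m=1..N. tree_expansion d N f yn (\<lambda>x. f m x j) (n' - r) (\<lambda>V. \<psi> (add_mset (Node m V) U))) =
          (\<Sum>m=1..N. tree_expansion d N f yn (\<lambda>x. f m x j) (n' - r) (\<lambda>V. \<xi> (add_mset (Node m V) U)))"
        proof (intro sum.cong refl less.IH)
          show "n' - r < n" using Suc by simp
          fix m V assume "m \<in> {1..N}" "\<forall>u\<in>#V. is_Ntree N u" "(\<Sum>u\<in>#V. num_verts u) = n' - r"
          with U r Suc show "\<psi> (add_mset (Node m V) U) = \<xi> (add_mset (Node m V) U)"
            by (intro less.prems) (simp_all add: is_Ntree_Node num_verts_Node)
        qed
      qed
    qed
  qed
qed

lemma tree_expansion_linear:
  "tree_expansion d N f yn F n (\<lambda>U. \<Sum>i\<in>I. c i * \<psi> i U) =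
     (\<Sum>i\<in>I. c i * tree_expansion d N f yn F n (\<psi> i))"
proof (induction n arbitrary: F \<psi> rule: less_induct)
  case (less n)
  show ?case
  proof (cases n)
    case 0
    then show ?thesis by (simp add: sum_distrib_left mult_ac)
  next
    case (Suc n')
    let ?E = "\<lambda>j r \<psi>. tree_expansion d N f yn (partial_deriv j F) r
      (\<lambda>U. \<Sum>m=1..N. tree_expansion d N f yn (\<lambda>x. f m x j) (n' - r) (\<lambda>V. \<psi> (add_mset (Node m V) U)))"
    have "?E j r (\<lambda>U. \<Sum>i\<in>I. c i * \<psi> i U) = (\<Sum>i\<in>I. c i * ?E j r (\<psi> i))" if "r \<in> {..n'}" for j r
    proof -
      have "(\<Sum>m=1..N. tree_expansion d N f yn (\<lambda>x. f m x j) (n' - r)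
            (\<lambda>V. \<Sum>i\<in>I. c i * \<psi> i (add_mset (Node m V) U))) =
          (\<Sum>i\<in>I. c i * (\<Sum>m=1..N. tree_expansion d N f yn (\<lambda>x. f m x j) (n' - r)
            (\<lambda>V. \<psi> i (add_mset (Node m V) U))))" for U
        unfolding sum_distrib_left
        by (subst sum.swap, intro sum.cong refl less.IH) (simp add: Suc)
      moreover have "r < n" using that Suc by simp
      ultimately show ?thesis
        by (simp only: less.IH)
    qed
    then have "tree_expansion d N f yn F n (\<lambda>U. \<Sum>i\<in>I. c i * \<psi> i U) =
        (\<Sum>j<d. \<Sum>r\<le>n'. \<Sum>i\<in>I. c i * (real (Suc (n' - r)) / real (Suc n') * ?E j r (\<psi> i)))"
      unfolding Suc tree_expansion.simps(2)
      by (intro sum.cong refl) (simp add: sum_distrib_left mult.left_commute)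
    also have "\<dots> = (\<Sum>i\<in>I. c i * tree_expansion d N f yn F n (\<psi> i))"
      unfolding Suc tree_expansion.simps(2) sum_distrib_left
      by (simp only: sum.swap[of _ _ I])
    finally show ?thesis .
  qed
qed

lemma tree_expansion_scale:
  "tree_expansion d N f yn F n (\<lambda>U. c * \<psi> U) = c * tree_expansion d N f yn F n \<psi>"
  using tree_expansion_linear[of d N f yn F n "\<lambda>_. c" "\<lambda>_. \<psi>" "{()}"] by simp

text \<open>
  If the coefficients of the coordinates of \<open>x\<close> are expanded in trees with weights \<open>\<phi>\<close>, then those of \<open>F \<circ> x\<close>
  are expanded in forests with the product weights. Multiplicativity is what makes the recursion close:
  the inner expansion of \<open>\<psi> (add_mset (Node m V) U)\<close> is then the coefficient of \<open>x\<^sub>j\<close> times the weight of \<open>U\<close>.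
  The coefficients of \<open>x\<close> are needed up to order \<open>n\<close> only, which permits the use of this lemma inside an
  induction that determines them.
\<close>

lemma taylor_coeff_compose_tree_expansion:
  assumes S: "open S" "0 \<in> S" and x: "\<And>t. t \<in> S \<Longrightarrow> x t \<in> Rn d" "x 0 = yn"
    and sm: "\<And>j. j < d \<Longrightarrow> smooth_real_on S (\<lambda>t. x t j)"
    and coeff: "\<And>j k. j < d \<Longrightarrow> k < n \<Longrightarrow> taylor_coeff (\<lambda>t. x t j) (Suc k) =
      (\<Sum>m=1..N. tree_expansion d N f yn (\<lambda>x. f m x j) k (\<lambda>V. \<phi> (Node m V)))"
    and F: "\<forall>k. C_class d k F"
  shows "taylor_coeff (\<lambda>t. F (x t)) n = tree_expansion d N f yn F n (\<lambda>U. \<Prod>u\<in>#U. \<phi> u)"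
  using coeff F
proof (induction n arbitrary: F rule: less_induct)
  case (less n)
  show ?case
  proof (cases n)
    case 0
    then show ?thesis by (simp add: taylor_coeff_0 x)
  next
    case (Suc n')
    have "taylor_coeff (\<lambda>t. partial_deriv j F (x t)) r * taylor_coeff (\<lambda>t. x t j) (Suc (n' - r)) =
        tree_expansion d N f yn (partial_deriv j F) r (\<lambda>U. \<Sum>m=1..N.
          tree_expansion d N f yn (\<lambda>x. f m x j) (n' - r) (\<lambda>V. \<Prod>u\<in>#add_mset (Node m V) U. \<phi> u))"
      if j: "j < d" and r: "r \<le> n'" for j r
    proof -
      let ?C = "\<Sum>m=1..N. tree_expansion d N f yn (\<lambda>x. f m x j) (n' - r) (\<lambda>V. \<phi> (Node m V))"
      have "taylor_coeff (\<lambda>t. x t j) (Suc (n' - r)) = ?C"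
        using j Suc by (intro less.prems) auto
      moreover have "taylor_coeff (\<lambda>t. partial_deriv j F (x t)) r =
          tree_expansion d N f yn (partial_deriv j F) r (\<lambda>U. \<Prod>u\<in>#U. \<phi> u)"
        using r Suc by (intro less.IH less.prems C_class_partial_deriv[OF less.prems(2) j]) auto
      moreover have "(\<Sum>m=1..N. tree_expansion d N f yn (\<lambda>x. f m x j) (n' - r)
            (\<lambda>V. \<Prod>u\<in>#add_mset (Node m V) U. \<phi> u)) = ?C * (\<Prod>u\<in>#U. \<phi> u)" for U
        by (simp add: mult.commute[of "\<phi> _"] tree_expansion_scale sum_distrib_left mult.commute[of "sum _ _"])
      ultimately show ?thesis
        by (simp add: tree_expansion_scale)
    qed
    moreover have "taylor_coeff (\<lambda>t. F (x t)) (Suc n') =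
      (\<Sum>j<d. \<Sum>r\<le>n'. real (Suc (n' - r)) / real (Suc n') *
        (taylor_coeff (\<lambda>t. partial_deriv j F (x t)) r * taylor_coeff (\<lambda>t. x t j) (Suc (n' - r))))"
      by (rule taylor_coeff_compose_Suc[OF S x(1) less.prems(2) sm])
    ultimately show ?thesis
      unfolding Suc tree_expansion.simps(2) by simp
  qed
qed

section \<open>Tree expansions of the exact and of the numerical solution\<close>

text \<open>
  Integrating \<open>y' = f(y)\<close> divides the coefficient of order \<open>n\<close> by \<open>n + 1\<close>, which is the number of vertices of the
  trees \<open>Node m V\<close> that arise; this is the recursion of the density.
\<close>

lemma exact_solution_coeff:
  assumes f: "\<forall>m\<in>{1..N}. smooth_field d (f m)" and y: "exact_solution d N f tn yn y" and k: "k < d"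
  shows "taylor_coeff (\<lambda>h. y (tn + h) k) (Suc n) =
    (\<Sum>m=1..N. tree_expansion d N f yn (\<lambda>x. f m x k) n (\<lambda>V. 1 / real (tree_density (Node m V))))"
proof -
  obtain \<epsilon> where \<epsilon>: "\<epsilon> > 0" "\<And>t. t \<in> {tn - \<epsilon><..<tn + \<epsilon>} \<Longrightarrow> y t \<in> Rn d"
    "\<And>t k. t \<in> {tn - \<epsilon><..<tn + \<epsilon>} \<Longrightarrow> k < d \<Longrightarrow>
       ((\<lambda>t. y t k) has_real_derivative (\<Sum>m=1..N. f m (y t) k)) (at t)"
    using y unfolding exact_solution_def by blast
  define S where "S = {-\<epsilon><..<\<epsilon>}"
  define x where "x h = y (tn + h)" for h
  have S: "open S" "0 \<in> S"
    using \<epsilon>(1) by (auto simp: S_def)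
  have x: "x h \<in> Rn d" if "h \<in> S" for h
    using that by (auto simp: x_def S_def intro: \<epsilon>(2))
  have x0: "x 0 = yn"
    using y by (simp add: x_def exact_solution_def)
  have dx: "((\<lambda>h. x h j) has_real_derivative (\<Sum>m=1..N. f m (x h) j)) (at h)"
    if "h \<in> S" "j < d" for h j
    using \<epsilon>(3)[of "tn + h" j] that DERIV_shift[of "\<lambda>t. y t j" _ h tn]
    by (simp add: x_def S_def add.commute)
  have fC: "\<forall>k. C_class d k (\<lambda>x. f m x j)" if "m \<in> {1..N}" "j < d" for m j
    using f that by (simp add: smooth_field_def)
  \<comment> \<open>bootstrapping: if \<open>x\<close> is \<open>n\<close> times differentiable, then so is \<open>x' = f(x)\<close>\<close>
  have "diff_times n S (\<lambda>h. x h j)" if "j < d" for n j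
    using that
  proof (induction n arbitrary: j)
    case (Suc n)
    have "diff_times n S (\<lambda>h. \<Sum>m=1..N. f m (x h) j)"
      by (intro diff_times_sum diff_times_compose[OF S(1) x fC Suc.IH] Suc.prems)
    then show ?case
      using dx Suc.prems unfolding diff_times.simps by (intro exI conjI ballI)
  qed simp
  then have sm: "smooth_real_on S (\<lambda>h. x h j)" if "j < d" for j
    using that by (simp add: smooth_real_on_iff_diff_times[OF S(1)])
  have "taylor_coeff (\<lambda>h. x h k) (Suc n) =
    (\<Sum>m=1..N. tree_expansion d N f yn (\<lambda>x. f m x k) n (\<lambda>V. 1 / real (tree_density (Node m V))))"
    using k
  proof (induction n arbitrary: k rule: less_induct)
    case (less n)
    have "taylor_coeff (\<lambda>h. x h k) (Suc n) = taylor_coeff (\<lambda>h. \<Sum>m=1..N. f m (x h) k) n / real (Suc n)"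
      by (rule taylor_coeff_Suc[OF S dx[OF _ less.prems]])
    also have "taylor_coeff (\<lambda>h. \<Sum>m=1..N. f m (x h) k) n = (\<Sum>m=1..N. taylor_coeff (\<lambda>h. f m (x h) k) n)"
      by (intro taylor_coeff_sum[OF S] smooth_real_on_compose[OF S(1) x fC sm] less.prems)
    also have "\<dots> = (\<Sum>m=1..N. tree_expansion d N f yn (\<lambda>x. f m x k) n
        (\<lambda>V. \<Prod>u\<in>#V. 1 / real (tree_density u)))"
      by (intro sum.cong refl taylor_coeff_compose_tree_expansion[OF S x x0 sm less.IH fC] less.prems)
    also have "\<dots> / real (Suc n) = (\<Sum>m=1..N. tree_expansion d N f yn (\<lambda>x. f m x k) n
        (\<lambda>V. 1 / real (Suc n) * (\<Prod>u\<in>#V. 1 / real (tree_density u))))"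
      unfolding tree_expansion_scale by (simp add: sum_divide_distrib)
    also have "\<dots> = (\<Sum>m=1..N. tree_expansion d N f yn (\<lambda>x. f m x k) n
        (\<lambda>V. 1 / real (tree_density (Node m V))))"
      by (intro sum.cong refl tree_expansion_cong)
        (simp only: one_divide_tree_density_Node num_verts_Node, simp)
    finally show ?case .
  qed
  then show ?thesis by (simp add: x_def)
qed

text \<open>
  Multiplying by a row of the tableau and summing over the stages is the recursion of the weight. The
  same computation (\<open>row\<close>) serves the stages, where it is fed with the coefficients of lower order, and
  the update.
\<close>

lemma gark_solution_coeff:
  assumes f: "\<forall>m\<in>{1..N}. smooth_field d (f m)" and z: "gark_solution d N s a b f yn z" and k: "k < d"
  shows "taylor_coeff (\<lambda>h. z h k) (Suc n) =
    (\<Sum>m=1..N. tree_expansion d N f yn (\<lambda>x. f m x k) n (\<lambda>V. tree_weight s a (Node m V) b))"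
proof -
  obtain \<epsilon> Y where \<epsilon>: "\<epsilon> > 0"
    and Y: "\<And>q i h. q \<in> {1..N} \<Longrightarrow> i \<in> {1..s q} \<Longrightarrow> h \<in> {-\<epsilon><..<\<epsilon>} \<Longrightarrow> Y h q i \<in> Rn d"
      "\<And>q i k. q \<in> {1..N} \<Longrightarrow> i \<in> {1..s q} \<Longrightarrow> k < d \<Longrightarrow> smooth_real_on {-\<epsilon><..<\<epsilon>} (\<lambda>h. Y h q i k)"
    and st: "\<And>h. h \<in> {-\<epsilon><..<\<epsilon>} \<Longrightarrow> gark_stages N s a f yn h (Y h)"
    and up: "\<And>h. h \<in> {-\<epsilon><..<\<epsilon>} \<Longrightarrow> z h = gark_update N s b f yn h (Y h)"
    using z unfolding gark_solution_def by blast
  define S where "S = {-\<epsilon><..<\<epsilon>}"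
  have S: "open S" "0 \<in> S"
    using \<epsilon> by (auto simp: S_def)
  note Y = Y[folded S_def]
  have st_eq: "Y h q i j = yn j + h * (\<Sum>m=1..N. \<Sum>l=1..s m. a q m i l * f m (Y h m l) j)"
    if "h \<in> S" "q \<in> {1..N}" "i \<in> {1..s q}" for h q i j
    using st that unfolding gark_stages_def S_def by simp
  have Y0: "Y 0 q i = yn" if "q \<in> {1..N}" "i \<in> {1..s q}" for q i
    using st_eq[OF S(2) that] by auto
  have fC: "\<forall>k. C_class d k (\<lambda>x. f m x j)" if "m \<in> {1..N}" "j < d" for m j
    using f that by (simp add: smooth_field_def)
  have sm: "smooth_real_on S (\<lambda>h. f m (Y h m l) j)" if "m \<in> {1..N}" "l \<in> {1..s m}" "j < d" for m l j
    by (rule smooth_real_on_compose[OF S(1) Y(1)[OF that(1,2)] fC[OF that(1,3)] Y(2)[OF that(1,2)]])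
  let ?\<phi> = "\<lambda>q i u. tree_weight s a u (\<lambda>m. a q m i)"
  have row: "taylor_coeff (\<lambda>h. c + h * (\<Sum>m=1..N. \<Sum>l=1..s m. g m l * f m (Y h m l) j)) (Suc n) =
      (\<Sum>m=1..N. tree_expansion d N f yn (\<lambda>x. f m x j) n (\<lambda>V. tree_weight s a (Node m V) g))"
    if hyp: "\<And>m l. m \<in> {1..N} \<Longrightarrow> l \<in> {1..s m} \<Longrightarrow> taylor_coeff (\<lambda>h. f m (Y h m l) j) n =
          tree_expansion d N f yn (\<lambda>x. f m x j) n (\<lambda>V. \<Prod>u\<in>#V. ?\<phi> m l u)"
      and j: "j < d" for g j n c
  proof -
    have "taylor_coeff (\<lambda>h. c + h * (\<Sum>m=1..N. \<Sum>l=1..s m. g m l * f m (Y h m l) j)) (Suc n) =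
        taylor_coeff (\<lambda>h. \<Sum>m=1..N. \<Sum>l=1..s m. g m l * f m (Y h m l) j) n"
      by (intro taylor_coeff_shift[OF S] smooth_real_on_sum smooth_real_on_mult smooth_real_on_const sm j S)
    also have "\<dots> = (\<Sum>m=1..N. taylor_coeff (\<lambda>h. \<Sum>l=1..s m. g m l * f m (Y h m l) j) n)"
      by (intro taylor_coeff_sum[OF S] smooth_real_on_sum smooth_real_on_mult smooth_real_on_const sm j S)
    also have "\<dots> = (\<Sum>m=1..N. \<Sum>l=1..s m. taylor_coeff (\<lambda>h. g m l * f m (Y h m l) j) n)"
      by (intro sum.cong refl taylor_coeff_sum[OF S] smooth_real_on_mult smooth_real_on_const sm j S)
    also have "\<dots> = (\<Sum>m=1..N. \<Sum>l=1..s m. g m l *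
        tree_expansion d N f yn (\<lambda>x. f m x j) n (\<lambda>V. \<Prod>u\<in>#V. ?\<phi> m l u))"
      by (intro sum.cong refl) (simp add: taylor_coeff_cmult[OF S] sm j hyp)
    also have "\<dots> = (\<Sum>m=1..N. tree_expansion d N f yn (\<lambda>x. f m x j) n (\<lambda>V. tree_weight s a (Node m V) g))"
      by (simp only: tree_expansion_linear tree_weight_Node)
    finally show ?thesis .
  qed
  have stage: "taylor_coeff (\<lambda>h. F (Y h q i)) n = tree_expansion d N f yn F n (\<lambda>V. \<Prod>u\<in>#V. ?\<phi> q i u)"
    if "q \<in> {1..N}" "i \<in> {1..s q}" "\<forall>k. C_class d k F" for q i F n
    using that
  proof (induction n arbitrary: q i F rule: less_induct)
    case (less n)
    have "taylor_coeff (\<lambda>h. Y h q i j) (Suc r) =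
        (\<Sum>m=1..N. tree_expansion d N f yn (\<lambda>x. f m x j) r (\<lambda>V. ?\<phi> q i (Node m V)))"
      if j: "j < d" and r: "r < n" for j r
    proof -
      have "taylor_coeff (\<lambda>h. Y h q i j) (Suc r) =
          taylor_coeff (\<lambda>h. yn j + h * (\<Sum>m=1..N. \<Sum>l=1..s m. a q m i l * f m (Y h m l) j)) (Suc r)"
        by (rule taylor_coeff_cong[OF S]) (rule st_eq[OF _ less.prems(1,2)])
      then show ?thesis
        by (simp only: row[OF less.IH[OF r _ _ fC[OF _ j]] j, where g = "\<lambda>m l. a q m i l"])
    qed
    then show ?case
      by (intro taylor_coeff_compose_tree_expansion[where S = S] S Y Y0 less.prems)
  qed
  have "taylor_coeff (\<lambda>h. z h k) (Suc n) =
      taylor_coeff (\<lambda>h. yn k + h * (\<Sum>q=1..N. \<Sum>i=1..s q. b q i * f q (Y h q i) k)) (Suc n)"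
    using up by (intro taylor_coeff_cong[OF S]) (simp add: gark_update_def S_def)
  then show ?thesis
    by (simp only: row[OF stage[OF _ _ fC[OF _ k]] k])
qed

text \<open>
  Both solutions have the same expansion but for the weights, and the weights agree on the trees that
  occur.
\<close>

lemma order_if_tree_conditions:
  assumes tc: "\<And>u. is_Ntree N u \<Longrightarrow> num_verts u \<le> p \<Longrightarrow> tree_weight s a u b = 1 / real (tree_density u)"
  shows "gark_has_order N s a b p"
  unfolding gark_has_order_def
proof (intro allI impI)
  fix d f tn yn y z n k
  assume f: "\<forall>m\<in>{1..N}. smooth_field d (f m)" and y: "exact_solution d N f tn yn y"
    and z: "gark_solution d N s a b f yn z" and n: "n \<le> p" and k: "k < d"
  show "taylor_coeff (\<lambda>h. z h k) n = taylor_coeff (\<lambda>h. y (tn + h) k) n"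
  proof (cases n)
    case 0
    obtain \<epsilon> Y where "\<epsilon> > 0" "\<forall>h\<in>{-\<epsilon><..<\<epsilon>}. z h = gark_update N s b f yn h (Y h)"
      using z unfolding gark_solution_def by metis
    then have "z 0 = yn"
      by (simp add: gark_update_def)
    moreover have "y tn = yn"
      using y by (simp add: exact_solution_def)
    ultimately show ?thesis
      by (simp add: 0 taylor_coeff_0)
  next
    case (Suc n')
    show ?thesis
      unfolding Suc gark_solution_coeff[OF f z k] exact_solution_coeff[OF f y k]
    proof (intro sum.cong refl tree_expansion_cong tc)
      fix m V assume "m \<in> {1..N}" "\<forall>u\<in>#V. is_Ntree N u" "(\<Sum>u\<in>#V. num_verts u) = n'"
      then show "is_Ntree N (Node m V)" "num_verts (Node m V) \<le> p"
        using n Suc by (simp_all add: is_Ntree_Node num_verts_Node)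
    qed
  qed
qed

section \<open>Polynomial maps are smooth\<close>

inductive polynomial_map :: "nat \<Rightarrow> ((nat \<Rightarrow> real) \<Rightarrow> real) \<Rightarrow> bool" for d where
  const: "polynomial_map d (\<lambda>x. c)"
| coord: "j < d \<Longrightarrow> polynomial_map d (\<lambda>x. x j)"
| add: "polynomial_map d F \<Longrightarrow> polynomial_map d G \<Longrightarrow> polynomial_map d (\<lambda>x. F x + G x)"
| mult: "polynomial_map d F \<Longrightarrow> polynomial_map d G \<Longrightarrow> polynomial_map d (\<lambda>x. F x * G x)"

lemma polynomial_map_continuous:
  "polynomial_map d F \<Longrightarrow> continuous_map (Euclidean_space d) euclideanreal F"
  unfolding continuous_map_Rn_iff_continuous_on
  by (induction rule: polynomial_map.induct)
    (auto intro!: continuous_intros continuous_on_product_coordinates intro: continuous_on_subset)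

lemma polynomial_map_partial:
  "polynomial_map d F \<Longrightarrow> \<exists>G. polynomial_map d G \<and>
     (\<forall>x. ((\<lambda>t. F (x(j := t))) has_real_derivative G x) (at (x j)))"
proof (induction rule: polynomial_map.induct)
  case (const c)
  show ?case by (intro exI[of _ "\<lambda>x. 0"]) (auto intro: polynomial_map.const)
next
  case (coord i)
  show ?case
    by (intro exI[of _ "\<lambda>x. if i = j then 1 else 0"])
      (auto intro: polynomial_map.const)
next
  case (add F G)
  then obtain F' G' where "polynomial_map d F'" "polynomial_map d G'"
    "\<And>x. ((\<lambda>t. F (x(j := t))) has_real_derivative F' x) (at (x j))"
    "\<And>x. ((\<lambda>t. G (x(j := t))) has_real_derivative G' x) (at (x j))" by blast
  then show ?case
    by (intro exI[of _ "\<lambda>x. F' x + G' x"] conjI allI polynomial_map.add DERIV_add)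
next
  case (mult F G)
  then obtain F' G' where *: "polynomial_map d F'" "polynomial_map d G'"
    and F': "\<And>x. ((\<lambda>t. F (x(j := t))) has_real_derivative F' x) (at (x j))"
    and G': "\<And>x. ((\<lambda>t. G (x(j := t))) has_real_derivative G' x) (at (x j))" by blast
  have "((\<lambda>t. F (x(j := t)) * G (x(j := t))) has_real_derivative F x * G' x + F' x * G x) (at (x j))" for x
    using DERIV_mult'[OF F'[of x] G'[of x]] by simp
  then show ?case
    using * mult.hyps
    by (intro exI[of _ "\<lambda>x. F x * G' x + F' x * G x"] conjI allI polynomial_map.add polynomial_map.mult)
qed

text \<open>
  The partial derivatives of a polynomial map are polynomial maps.
\<close>

lemma polynomial_map_C_class: "polynomial_map d F \<Longrightarrow> C_class d k F"
proof (induction k arbitrary: F)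
  case 0
  then show ?case by (simp add: polynomial_map_continuous)
next
  case (Suc k)
  have "(\<forall>x\<in>Rn d. (\<lambda>t. F (x(j := t))) differentiable (at (x j))) \<and> C_class d k (partial_deriv j F)" for j
  proof -
    obtain G where G: "polynomial_map d G"
      "\<And>x. ((\<lambda>t. F (x(j := t))) has_real_derivative G x) (at (x j))"
      using polynomial_map_partial[OF Suc.prems] by blast
    have "partial_deriv j F = G"
      using DERIV_imp_deriv[OF G(2)] by (auto simp: partial_deriv_def)
    then show ?thesis
      using Suc.IH[OF G(1)] G(2) real_differentiable_def by blast
  qed
  then show ?case
    by (simp add: polynomial_map_continuous[OF Suc.prems])
qed

lemma polynomial_map_prod_mset:
  "(\<And>w. w \<in># M \<Longrightarrow> idx w < d) \<Longrightarrow> polynomial_map d (\<lambda>x. \<Prod>w\<in>#M. x (idx w))"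
  by (induction M) (auto intro!: polynomial_map.const polynomial_map.mult polynomial_map.coord)

section \<open>A test system that isolates one tree\<close>

lemma finite_subtree_closed_superset:
  "is_Ntree N u \<Longrightarrow> \<exists>T. finite T \<and> u \<in> T \<and> (\<forall>w\<in>T. is_Ntree N w \<and> set_mset (subtrees w) \<subseteq> T)"
proof (induction u)
  case (Node m us)
  then have "\<forall>w\<in>#us. \<exists>T. finite T \<and> w \<in> T \<and> (\<forall>w\<in>T. is_Ntree N w \<and> set_mset (subtrees w) \<subseteq> T)"
    by (simp add: is_Ntree_Node)
  then obtain T where T: "\<And>w. w \<in># us \<Longrightarrow> finite (T w)" "\<And>w. w \<in># us \<Longrightarrow> w \<in> T w"
    "\<And>w v. w \<in># us \<Longrightarrow> v \<in> T w \<Longrightarrow> is_Ntree N v \<and> set_mset (subtrees v) \<subseteq> T w"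
    by metis
  let ?T = "insert (Node m us) (\<Union>w\<in>set_mset us. T w)"
  have "is_Ntree N v \<and> set_mset (subtrees v) \<subseteq> ?T" if "v \<in> ?T" for v
  proof (cases "v = Node m us")
    case True
    then show ?thesis using Node.prems T(2) by auto
  next
    case False
    with that obtain w where "w \<in># us" "v \<in> T w" by blast
    with T(3) show ?thesis by fast
  qed
  moreover have "finite ?T" using T(1) by simp
  ultimately show ?case by blast
qed

lemma prod_mset_mult_power:
  fixes c :: "'a \<Rightarrow> 'b::comm_semiring_1"
  shows "(\<Prod>w\<in>#M. c w * h ^ n w) = (\<Prod>w\<in>#M. c w) * h ^ (\<Sum>w\<in>#M. n w)"
  by (induction M) (simp_all add: power_add mult_ac)

text \<open>
  The coordinates of the test system are indexed by a finite set \<open>T\<close> of trees that contains \<open>u\<close> and is closed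
  under taking subtrees. The field of colour \<open>m\<close> has in coordinate \<open>w = [w\<^sub>1, \<dots>, w\<^sub>k]\<close> with root colour \<open>m\<close> the
  value \<open>x\<^bsub>w\<^sub>1\<^esub> * \<dots> * x\<^bsub>w\<^sub>k\<^esub>\<close>, and \<open>0\<close> if the root colour of \<open>w\<close> differs from \<open>m\<close>. As coordinate \<open>w\<close> is fed by smaller trees
  only, everything started at the origin can be solved explicitly: exact solution, stages and update
  all have the form \<open>c w * h ^ num_verts w\<close>, where \<open>c\<close> is the reciprocal density for the exact solution and
  the weight for the method. Comparing the coordinates \<open>u\<close> gives the condition for \<open>u\<close>.
\<close>

lemma tree_condition_if_order:
  assumes ord: "gark_has_order N s a b p" and u: "is_Ntree N u" "num_verts u \<le> p"
  shows "tree_weight s a u b = 1 / real (tree_density u)"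
proof -
  obtain T where T: "finite T" "u \<in> T"
    and TN: "\<And>w. w \<in> T \<Longrightarrow> is_Ntree N w" and Tsub: "\<And>w v. w \<in> T \<Longrightarrow> v \<in># subtrees w \<Longrightarrow> v \<in> T"
    using finite_subtree_closed_superset[OF u(1)] by blast
  define d where "d = card T"
  obtain idx where idx: "bij_betw idx T {..<d}"
    using ex_bij_betw_finite_nat[OF T(1)] by (auto simp: d_def atLeast0LessThan)
  define tr where "tr = inv_into T idx"
  have idx_lt: "idx w < d" and tr_idx: "tr (idx w) = w" if "w \<in> T" for w
    using idx that by (auto simp: bij_betw_def tr_def)
  have tr_T: "tr k \<in> T" if "k < d" for k
    using idx that by (metis bij_betw_def inv_into_into lessThan_iff tr_def)
  define f where "f m x = (\<lambda>k. if k < d \<and> root_colour (tr k) = m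
    then \<Prod>w\<in>#subtrees (tr k). x (idx w) else 0)" for m and x :: "nat \<Rightarrow> real"
  \<comment> \<open>the common form of all solutions\<close>
  define X where "X c h = (\<lambda>k. if k < d then c (tr k) * h ^ num_verts (tr k) else 0)"
    for c :: "ntree \<Rightarrow> real" and h :: real
  have XRn: "X c h \<in> Rn d" for c h
    by (simp add: X_def topspace_Euclidean_space)
  have X_smooth: "smooth_real_on S (\<lambda>h. X c h k)" if "open S" for S c k
    by (cases "k < d")
      (simp_all add: X_def that smooth_real_on_mult smooth_real_on_const smooth_real_on_power)
  have X0: "X c 0 = (\<lambda>k. 0)" for c
    by (simp add: X_def fun_eq_iff zero_power[OF num_verts_pos])
  have f_X: "f m (X c h) k = (if root_colour (tr k) = m then
      (\<Prod>w\<in>#subtrees (tr k). c w) * h ^ (\<Sum>w\<in>#subtrees (tr k). num_verts w) else 0)"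
    if k: "k < d" for m c h k
  proof -
    have "(\<Prod>w\<in>#subtrees (tr k). X c h (idx w)) = (\<Prod>w\<in>#subtrees (tr k). c w * h ^ num_verts w)"
      using Tsub[OF tr_T[OF k]]
      by (intro arg_cong[where f = prod_mset] image_mset_cong) (simp add: X_def idx_lt tr_idx)
    also have "\<dots> = (\<Prod>w\<in>#subtrees (tr k). c w) * h ^ (\<Sum>w\<in>#subtrees (tr k). num_verts w)"
      by (rule prod_mset_mult_power)
    finally show ?thesis
      using k by (simp add: f_def)
  qed
  have tr_Node: "tr k = Node (root_colour (tr k)) (subtrees (tr k))" for k
    by simp
  have col: "root_colour (tr k) \<in> {1..N}" if "k < d" for k
    using TN[OF tr_T[OF that]] tr_Node[of k] is_Ntree_Node by metis
  have nv: "num_verts (tr k) = Suc (\<Sum>w\<in>#subtrees (tr k). num_verts w)" for k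
    using tr_Node[of k] num_verts_Node by metis
  have "smooth_field d (f m)" for m
  proof -
    have "C_class d n (\<lambda>x. f m x k)" if k: "k < d" for k n
    proof (cases "root_colour (tr k) = m")
      case True
      then show ?thesis
        using k Tsub[OF tr_T[OF k]] idx_lt
        by (auto simp: f_def intro!: polynomial_map_C_class polynomial_map_prod_mset)
    next
      case False
      then show ?thesis
        by (auto simp: f_def intro!: polynomial_map_C_class polynomial_map.const)
    qed
    then show ?thesis
      by (auto simp: smooth_field_def f_def topspace_Euclidean_space)
  qed
  moreover have "(\<lambda>k. 0) \<in> Rn d"
    by (simp add: topspace_Euclidean_space)
  moreover have "exact_solution d N f 0 (\<lambda>k. 0) (X (\<lambda>w. 1 / real (tree_density w)))"
  proof -
    let ?c = "\<lambda>w. 1 / real (tree_density w)"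
    have "((\<lambda>t. X ?c t k) has_real_derivative (\<Sum>m=1..N. f m (X ?c t) k)) (at t)" if k: "k < d" for t k
    proof -
      have "(\<Sum>m=1..N. f m (X ?c t) k) =
          (\<Prod>w\<in>#subtrees (tr k). ?c w) * t ^ (\<Sum>w\<in>#subtrees (tr k). num_verts w)"
        using col[OF k] by (simp add: f_X[OF k])
      also have "(\<Prod>w\<in>#subtrees (tr k). ?c w) = ?c (tr k) * real (num_verts (tr k))"
        using one_divide_tree_density_Node[of "root_colour (tr k)" "subtrees (tr k)"] num_verts_pos[of "tr k"]
        by (simp add: field_simps)
      finally have field: "(\<Sum>m=1..N. f m (X ?c t) k) =
          ?c (tr k) * real (num_verts (tr k)) * t ^ (\<Sum>w\<in>#subtrees (tr k). num_verts w)" .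
      have "((\<lambda>t. ?c (tr k) * t ^ num_verts (tr k)) has_real_derivative
          ?c (tr k) * (real (num_verts (tr k)) * t ^ (num_verts (tr k) - Suc 0))) (at t)"
        by (intro DERIV_cmult DERIV_pow)
      moreover have "num_verts (tr k) - Suc 0 = (\<Sum>w\<in>#subtrees (tr k). num_verts w)"
        using nv[of k] by simp
      ultimately show ?thesis
        unfolding field using k by (simp add: X_def mult.assoc)
    qed
    then show ?thesis
      unfolding exact_solution_def using XRn X0 by (auto intro: exI[of _ 1])
  qed
  moreover have "gark_solution d N s a b f (\<lambda>k. 0) (X (\<lambda>w. tree_weight s a w b))"
  proof -
    let ?Y = "\<lambda>h q i. X (\<lambda>w. tree_weight s a w (\<lambda>m. a q m i)) h"
    have row: "X (\<lambda>w. tree_weight s a w g) h =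
        (\<lambda>k. 0 + h * (\<Sum>m=1..N. \<Sum>j=1..s m. g m j * f m (?Y h m j) k))" for g h
    proof
      fix k
      show "X (\<lambda>w. tree_weight s a w g) h k =
          0 + h * (\<Sum>m=1..N. \<Sum>j=1..s m. g m j * f m (?Y h m j) k)"
      proof (cases "k < d")
        case True
        let ?m = "root_colour (tr k)" and ?us = "subtrees (tr k)"
        have "(\<Sum>m=1..N. \<Sum>j=1..s m. g m j * f m (?Y h m j) k) =
            (\<Sum>m=1..N. if ?m = m then \<Sum>j=1..s m. g m j * f m (?Y h m j) k else 0)"
          by (intro sum.cong refl) (simp add: f_def)
        also have "\<dots> = (\<Sum>j=1..s ?m. g ?m j * f ?m (?Y h ?m j) k)"
          using col[OF True] by simp
        also have "\<dots> = tree_weight s a (Node ?m ?us) g * h ^ (\<Sum>w\<in>#?us. num_verts w)"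
          unfolding tree_weight_Node f_X[OF True] by (simp add: sum_distrib_right mult.assoc)
        finally show ?thesis
          using True by (simp add: X_def nv)
      qed (simp add: X_def f_def)
    qed
    show ?thesis
      unfolding gark_solution_def
    proof (intro exI[of _ "1::real"] exI[of _ ?Y] conjI ballI)
      show "gark_stages N s a f (\<lambda>k. 0) h (?Y h)" for h
        unfolding gark_stages_def using row[of "\<lambda>m. a _ m _" h] by blast
      show "X (\<lambda>w. tree_weight s a w b) h = gark_update N s b f (\<lambda>k. 0) h (?Y h)" for h
        unfolding gark_update_def by (rule row)
    qed (auto simp: XRn X_smooth)
  qed
  ultimately have "\<forall>n\<le>p. \<forall>k<d. taylor_coeff (\<lambda>h. X (\<lambda>w. tree_weight s a w b) h k) n =
      taylor_coeff (\<lambda>h. X (\<lambda>w. 1 / real (tree_density w)) (0 + h) k) n"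
    using ord unfolding gark_has_order_def by blast
  then have "taylor_coeff (\<lambda>h. X (\<lambda>w. tree_weight s a w b) h (idx u)) (num_verts u) =
      taylor_coeff (\<lambda>h. X (\<lambda>w. 1 / real (tree_density w)) (0 + h) (idx u)) (num_verts u)"
    using u(2) idx_lt[OF T(2)] by blast
  then have "taylor_coeff (\<lambda>h. tree_weight s a u b * h ^ num_verts u) (num_verts u) =
      taylor_coeff (\<lambda>h. 1 / real (tree_density u) * h ^ num_verts u) (num_verts u)"
    by (simp only: X_def idx_lt[OF T(2)] tr_idx[OF T(2)] add_0 if_True)
  then show ?thesis
    unfolding taylor_coeff_monomial .
qed

section \<open>The order conditions\<close>

theorem theorem2p3:
  fixes N p :: nat
    and s :: "nat \<Rightarrow> nat"
    and a :: "nat \<Rightarrow> nat \<Rightarrow> nat \<Rightarrow> nat \<Rightarrow> real"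
    and b :: "nat \<Rightarrow> nat \<Rightarrow> real"
  assumes "N \<ge> 1"
    and "\<And>q. q \<in> {1..N} \<Longrightarrow> s q \<ge> 1"
  shows "gark_has_order N s a b p \<longleftrightarrow>
    (\<forall>u. is_Ntree N u \<and> 1 \<le> num_verts u \<and> num_verts u \<le> p \<longrightarrow>
       (\<Sum>\<iota> \<in> (\<Pi>\<^sub>E v\<in>verts u. {1..s (colour u v)}).
          b (colour u []) (\<iota> []) *
          (\<Prod>(v, w)\<in>edges u. a (colour u v) (colour u w) (\<iota> v) (\<iota> w)))
       = 1 / real (tree_density u))"
  unfolding sum_over_index_assignments
  using order_if_tree_conditions tree_condition_if_order num_verts_pos
  by (metis One_nat_def Suc_leI)

end
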